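(* Let $g\in H^\infty(\mathbb{D})$ satisfy: $g(\mathbb{D})\cap\mathbb{D}=\varnothing$; $|g|>1$ almost everywhere on $\mathbb{T}$; there is a bounded holomorphic function $u:\mathbb{D}\to\mathbb{C}$ with $g=e^u$; and the intersection of the closure $\overline{u(\mathbb{D})}$ with the imaginary axis $i\mathbb{R}$ is a single point. Let $f\in H^2(\mathbb{D})$, $f\neq 0$. Then for every $k>0$, $\limsup_{n\to\infty}n^{-k}\|(T_g^* )^nf\|=+\infty$.
   Context: $\mathbb{D}$ is the open unit disk, $\mathbb{T}$ the unit circle; $H^\infty$ functions are identified with their boundary values on $\mathbb{T}$. $H^2(\mathbb{D})\subseteq L^2(\mathbb{T})$; for $g\in L^\infty(\mathbb{T})$, $T_g=PM_g$ with $M_g$ multiplication by $g$ and $P$ the orthogonal projection of $L^2(\mathbb{T})$ onto $H^2(\mathbb{D})$; $T_g^*$ is the Hilbert space adjoint. *)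

theory Defs
  imports "HOL-Complex_Analysis.Complex_Analysis"
begin

text \<open>H^2 of the disc is identified (isometrically) with the space of square-summable
  Taylor coefficient sequences: f(z) = sum a_n z^n.\<close>

definition H2 :: "(nat \<Rightarrow> complex) set" where
  "H2 = {a. summable (\<lambda>n. (cmod (a n))\<^sup>2)}"

definition h2_inner :: "(nat \<Rightarrow> complex) \<Rightarrow> (nat \<Rightarrow> complex) \<Rightarrow> complex" where
  "h2_inner a b = (\<Sum>n. a n * cnj (b n))"

definition h2_norm :: "(nat \<Rightarrow> complex) \<Rightarrow> real" where
  "h2_norm a = sqrt (\<Sum>n. (cmod (a n))\<^sup>2)"

definition taylor_coeff :: "(complex \<Rightarrow> complex) \<Rightarrow> nat \<Rightarrow> complex" where
  "taylor_coeff g n = (deriv ^^ n) g 0 / of_nat (fact n)"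

definition Hinf :: "(complex \<Rightarrow> complex) set" where
  "Hinf = {g. g holomorphic_on ball 0 1 \<and> bounded (g ` ball 0 1)}"

text \<open>Toeplitz operator with analytic symbol g: T_g f = P(g f) = g f, written on
  Taylor coefficients as the Cauchy product.\<close>
definition toeplitz :: "(complex \<Rightarrow> complex) \<Rightarrow> (nat \<Rightarrow> complex) \<Rightarrow> (nat \<Rightarrow> complex)" where
  "toeplitz g a = (\<lambda>n. \<Sum>k\<le>n. taylor_coeff g k * a (n - k))"

definition toeplitz_adj :: "(complex \<Rightarrow> complex) \<Rightarrow> (nat \<Rightarrow> complex) \<Rightarrow> (nat \<Rightarrow> complex)" where
  "toeplitz_adj g b = (THE c. c \<in> H2 \<and> (\<forall>a\<in>H2. h2_inner (toeplitz g a) b = h2_inner a c))"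

definition bdry_gt_one :: "(complex \<Rightarrow> complex) \<Rightarrow> bool" where
  "bdry_gt_one g \<longleftrightarrow>
     (AE t in lebesgue_on {0..2*pi}.
        \<exists>L. ((\<lambda>r. g (complex_of_real r * cis t)) \<longlongrightarrow> L) (at_left 1) \<and> cmod L > 1)"

end

theory Submission
  imports Defs
begin

text \<open>Normalise \<open>u\<close> to \<open>v = u - c\<close>, whose range meets the imaginary axis only at \<open>0\<close>
  in the closure, and consider \<open>\<phi> t = \<langle>exp (t v) f, f\<rangle>\<close>, an entire function of exponential
  type. If the adjoint powers grew only polynomially along \<open>f\<close>, then \<open>\<phi>\<close> would grow polynomially
  on the positive half-line. By compactness, for every \<open>\<epsilon> > 0\<close> we have
  \<open>\<bar>Im v\<bar> \<le> M * Re v + \<epsilon>\<close> for some \<open>M\<close>, so \<open>\<phi>\<close> is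
  \<open>O(exp (\<epsilon> * \<bar>Im t\<bar>))\<close> in a thin sector around the negative half-line. The two
  complementary sectors have opening less than \<open>pi\<close>, so Phragmen-Lindelof applies there; letting
  \<open>\<epsilon>\<close> tend to \<open>0\<close> shows that \<open>\<phi>\<close> is a polynomial, and being bounded on the negative half-line
  it is constant. Finally \<open>Re v > 0\<close> makes \<open>exp (- s v)\<close> tend to \<open>0\<close> weakly as \<open>s\<close> tends to
  infinity, whence \<open>\<langle>f, f\<rangle> = 0\<close>.\<close>

subsection \<open>Square-summable sequences\<close>

text \<open>The finite Cauchy-Schwarz inequality bounds all partial sums by the product of the
  norms; this one bound gives both absolute convergence and the estimate of the sum.\<close>

lemma H2_cauchy_schwarz:
  assumes a: "a \<in> H2" and b: "b \<in> H2"
  shows summable_h2_inner: "summable (\<lambda>n. cmod (a n * cnj (b n)))"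
    and norm_h2_inner_le: "cmod (h2_inner a b) \<le> h2_norm a * h2_norm b"
proof -
  have bound: "(\<Sum>n<N. cmod (a n * cnj (b n))) \<le> h2_norm a * h2_norm b" for N
  proof -
    have le: "L2_set (\<lambda>n. cmod (c n)) {..<N} \<le> h2_norm c" if "c \<in> H2" for c
      using that unfolding L2_set_def h2_norm_def H2_def
      by (auto intro!: sum_le_suminf)
    have "(\<Sum>n<N. cmod (a n * cnj (b n))) = (\<Sum>n<N. \<bar>cmod (a n)\<bar> * \<bar>cmod (b n)\<bar>)"
      by (simp add: norm_mult)
    also have "\<dots> \<le> L2_set (\<lambda>n. cmod (a n)) {..<N} * L2_set (\<lambda>n. cmod (b n)) {..<N}"
      by (rule L2_set_mult_ineq)
    also have "\<dots> \<le> h2_norm a * h2_norm b"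
      using a le[OF a] le[OF b]
      by (intro mult_mono) (auto simp: h2_norm_def H2_def intro!: suminf_nonneg)
    finally show ?thesis .
  qed
  show s: "summable (\<lambda>n. cmod (a n * cnj (b n)))"
    by (rule summableI_nonneg_bounded[OF _ bound]) simp
  have "cmod (h2_inner a b) \<le> (\<Sum>n. cmod (a n * cnj (b n)))"
    unfolding h2_inner_def using s by (rule summable_norm)
  also have "\<dots> \<le> h2_norm a * h2_norm b"
    using s bound by (rule suminf_le_const)
  finally show "cmod (h2_inner a b) \<le> h2_norm a * h2_norm b" .
qed

lemma h2_inner_sums:
  assumes "a \<in> H2" "b \<in> H2"
  shows "(\<lambda>n. a n * cnj (b n)) sums h2_inner a b"
  unfolding h2_inner_def
  by (rule summable_sums[OF summable_norm_cancel[OF summable_h2_inner[OF assms]]])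

lemma h2_norm_nonneg: "a \<in> H2 \<Longrightarrow> 0 \<le> h2_norm a"
  unfolding h2_norm_def H2_def by (auto intro: suminf_nonneg)

lemma H2_finite_support:
  assumes "\<And>n. n \<ge> N \<Longrightarrow> a n = 0"
  shows "a \<in> H2" and "(h2_norm a)\<^sup>2 = (\<Sum>n<N. (cmod (a n))\<^sup>2)"
proof -
  have "(\<lambda>n. (cmod (a n))\<^sup>2) sums (\<Sum>n<N. (cmod (a n))\<^sup>2)"
    using assms by (intro sums_finite) auto
  then show "a \<in> H2" "(h2_norm a)\<^sup>2 = (\<Sum>n<N. (cmod (a n))\<^sup>2)"
    by (auto simp: H2_def h2_norm_def sums_iff sum_nonneg)
qed

lemma H2_memI_bounded:
  assumes "\<And>N. (\<Sum>n<N. (cmod (a n))\<^sup>2) \<le> C\<^sup>2" "C \<ge> 0"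
  shows "a \<in> H2" and "h2_norm a \<le> C"
proof -
  have s: "summable (\<lambda>n. (cmod (a n))\<^sup>2)"
    by (rule summableI_nonneg_bounded[OF _ assms(1)]) simp
  then show "a \<in> H2" by (simp add: H2_def)
  have "(\<Sum>n. (cmod (a n))\<^sup>2) \<le> C\<^sup>2"
    using s assms(1) by (rule suminf_le_const)
  then show "h2_norm a \<le> C"
    unfolding h2_norm_def using assms(2) by (simp add: real_le_lsqrt)
qed

text \<open>Truncation errors below are always expressed through this tail, so its vanishing norm
  controls them uniformly in the other data.\<close>

definition h2_tail :: "nat \<Rightarrow> (nat \<Rightarrow> complex) \<Rightarrow> nat \<Rightarrow> complex" where
  "h2_tail N a = (\<lambda>n. if n < N then 0 else a n)"

lemma h2_tail:
  assumes "a \<in> H2"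
  shows h2_tail_in_H2: "h2_tail N a \<in> H2"
    and h2_tail_tendsto_0: "(\<lambda>N. h2_norm (h2_tail N a)) \<longlonglongrightarrow> 0"
proof -
  have s: "summable (\<lambda>n. (cmod (a n))\<^sup>2)" using assms by (simp add: H2_def)
  have eq: "(\<lambda>n. (cmod (h2_tail N a n))\<^sup>2) sums ((\<Sum>n. (cmod (a n))\<^sup>2) - (\<Sum>n<N. (cmod (a n))\<^sup>2))" for N
  proof -
    have "(\<lambda>n. if n \<in> {..<N} then (cmod (a n))\<^sup>2 else 0) sums (\<Sum>n\<in>{..<N}. (cmod (a n))\<^sup>2)"
      by (rule sums_If_finite_set) simp
    from sums_diff[OF summable_sums[OF s] this] show ?thesis
      by (rule sums_cong[THEN iffD1, rotated]) (auto simp: h2_tail_def)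
  qed
  show "h2_tail N a \<in> H2" using eq by (auto simp: H2_def sums_iff)
  have "(\<lambda>N. sqrt ((\<Sum>n. (cmod (a n))\<^sup>2) - (\<Sum>n<N. (cmod (a n))\<^sup>2))) \<longlonglongrightarrow> sqrt ((\<Sum>n. (cmod (a n))\<^sup>2) - (\<Sum>n. (cmod (a n))\<^sup>2))"
    using summable_LIMSEQ[OF s] by (intro tendsto_intros)
  moreover have "h2_norm (h2_tail N a) = sqrt ((\<Sum>n. (cmod (a n))\<^sup>2) - (\<Sum>n<N. (cmod (a n))\<^sup>2))" for N
    using eq[of N] by (simp add: h2_norm_def sums_iff)
  ultimately show "(\<lambda>N. h2_norm (h2_tail N a)) \<longlonglongrightarrow> 0" by simp
qed

subsection \<open>Parseval's identity on a circle\<close>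

lemma has_integral_cis_int:
  "((\<lambda>t. cis (of_int k * t)) has_integral (if k = 0 then 2 * pi else 0)) {0..2*pi}"
proof (cases "k = 0")
  case True
  then show ?thesis
    using has_integral_const_real[of "1::complex" 0 "2*pi"] by (simp add: scaleR_conv_of_real)
next
  case False
  have "((\<lambda>t. cis (of_int k * t)) has_integral
      (cis (of_int k * (2*pi)) / (\<i> * of_int k) - cis (of_int k * 0) / (\<i> * of_int k))) {0..2*pi}"
  proof (rule fundamental_theorem_of_calculus)
    fix t :: real
    have "((\<lambda>t. exp (\<i> * of_int k * of_real t) / (\<i> * of_int k)) has_vector_derivative
            exp (\<i> * of_int k * of_real t)) (at t within {0..2*pi})"
      by (rule has_vector_derivative_real_field)
         (use False in \<open>auto intro!: derivative_eq_intros\<close>)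
    then show "((\<lambda>t. cis (of_int k * t) / (\<i> * of_int k)) has_vector_derivative
            cis (of_int k * t)) (at t within {0..2*pi})"
      by (simp add: cis_conv_exp mult_ac)
  qed simp
  moreover have "cis (of_int k * (2*pi)) = 1"
    using cis_multiple_2pi[of "of_int k"] by (simp add: mult_ac)
  ultimately show ?thesis using False by simp
qed

text \<open>The square expands into a double sum of characters, of which only the diagonal has a
  nonzero integral.\<close>

lemma parseval_trig_polynomial:
  "((\<lambda>t. (cmod (\<Sum>n<N. d n * cis (real n * t)))\<^sup>2) has_integral 2 * pi * (\<Sum>n<N. (cmod (d n))\<^sup>2)) {0..2*pi}"
proof -
  have eq: "complex_of_real ((cmod (\<Sum>n<N. d n * cis (real n * t)))\<^sup>2) =
      (\<Sum>n<N. \<Sum>m<N. (d n * cnj (d m)) * cis (of_int (int n - int m) * t))" for t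
    unfolding complex_norm_square
    by (simp add: sum_product cis_mult cis_cnj algebra_simps flip: cis_divide)
  have "((\<lambda>t. \<Sum>n<N. \<Sum>m<N. (d n * cnj (d m)) * cis (of_int (int n - int m) * t)) has_integral
      (\<Sum>n<N. \<Sum>m<N. (d n * cnj (d m)) * (if int n - int m = 0 then 2 * pi else 0))) {0..2*pi}"
    by (intro has_integral_sum has_integral_mult_right has_integral_cis_int) auto
  then have "((\<lambda>t. complex_of_real ((cmod (\<Sum>n<N. d n * cis (real n * t)))\<^sup>2)) has_integral
      (\<Sum>n<N. \<Sum>m<N. (d n * cnj (d m)) * (if int n - int m = 0 then 2 * pi else 0))) {0..2*pi}"
    by (simp only: eq)
  from has_integral_linear[OF this bounded_linear_Re]
  have "((\<lambda>t. (cmod (\<Sum>n<N. d n * cis (real n * t)))\<^sup>2) has_integral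
      Re (\<Sum>n<N. \<Sum>m<N. (d n * cnj (d m)) * (if int n - int m = 0 then 2 * pi else 0))) {0..2*pi}"
    by (simp only: o_def Re_complex_of_real)
  also have "(\<Sum>n<N. \<Sum>m<N. (d n * cnj (d m)) * (if int n - int m = 0 then 2 * pi else 0)) =
      (\<Sum>n<N. \<Sum>m<N. if n = m then d n * cnj (d m) * (2 * pi) else 0)"
    by (intro sum.cong refl) auto
  also have "\<dots> = (\<Sum>n<N. d n * cnj (d n) * (2 * pi))"
    by simp
  also have "\<dots> = of_real (2 * pi * (\<Sum>n<N. (cmod (d n))\<^sup>2))"
    by (simp add: sum_distrib_left mult_ac flip: complex_norm_square)
  finally show ?thesis by simp
qed

text \<open>Absolute summability gives uniform convergence of the partial sums, so the integrals in
  the finite identity pass to the limit.\<close>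

lemma parseval_circle:
  assumes "summable (\<lambda>n. cmod (d n))"
  shows "summable (\<lambda>n. (cmod (d n))\<^sup>2)"
    and "((\<lambda>t. (cmod (\<Sum>n. d n * cis (real n * t)))\<^sup>2) has_integral 2 * pi * (\<Sum>n. (cmod (d n))\<^sup>2)) {0..2*pi}"
proof -
  let ?S = "\<lambda>N t. \<Sum>n<N. d n * cis (real n * t)"
  have lim: "uniform_limit {0..2*pi} ?S (\<lambda>t. \<Sum>n. d n * cis (real n * t)) sequentially"
    using assms by (intro Weierstrass_m_test) (auto simp: norm_mult)
  define B where "B = (\<Sum>n. cmod (d n))"
  have S_le: "cmod (?S N t) \<le> B" for N t
  proof -
    have "cmod (?S N t) \<le> (\<Sum>n<N. cmod (d n))"
      by (rule order.trans[OF norm_sum]) (simp add: norm_mult)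
    also have "\<dots> \<le> B" unfolding B_def using assms by (intro sum_le_suminf) auto
    finally show ?thesis .
  qed
  have lim_le: "cmod (\<Sum>n. d n * cis (real n * t)) \<le> B" for t
    unfolding B_def using assms
    by (intro order.trans[OF summable_norm]) (auto simp: norm_mult)
  \<comment> \<open>Squaring preserves uniform convergence because the limit function is bounded by
    \<open>B\<close>.\<close>
  have lim': "uniform_limit {0..2*pi} (\<lambda>N t. (cmod (?S N t))\<^sup>2)
      (\<lambda>t. (cmod (\<Sum>n. d n * cis (real n * t)))\<^sup>2) sequentially"
    unfolding power2_eq_square
    using lim_le
    by (intro bounded_bilinear.bounded_uniform_limit[OF bounded_bilinear_mult] uniform_limit_norm lim)
       (auto intro!: boundedI[where B = B])
  have cont: "continuous_on {0..2*pi} (\<lambda>t. (cmod (?S N t))\<^sup>2)" for N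
    by (intro continuous_intros)
  obtain I J where IJ: "\<And>N. ((\<lambda>t. (cmod (?S N t))\<^sup>2) has_integral I N) {0..2*pi}"
      "((\<lambda>t. (cmod (\<Sum>n. d n * cis (real n * t)))\<^sup>2) has_integral J) {0..2*pi}" "I \<longlonglongrightarrow> J"
    using uniform_limit_integral[OF lim' cont sequentially_bot] by blast
  have I: "I N = 2 * pi * (\<Sum>n<N. (cmod (d n))\<^sup>2)" for N
    using IJ(1) parseval_trig_polynomial by (rule has_integral_unique)
  have "(\<lambda>N. I N / (2*pi)) \<longlonglongrightarrow> J / (2*pi)" by (intro tendsto_intros IJ) simp
  then have "(\<lambda>n. (cmod (d n))\<^sup>2) sums (J / (2*pi))" by (simp add: I sums_def)
  then show "summable (\<lambda>n. (cmod (d n))\<^sup>2)"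
    and "((\<lambda>t. (cmod (\<Sum>n. d n * cis (real n * t)))\<^sup>2) has_integral 2 * pi * (\<Sum>n. (cmod (d n))\<^sup>2)) {0..2*pi}"
    using IJ(2) by (auto simp: sums_iff)
qed

subsection \<open>Analytic Toeplitz operators\<close>

lemma taylor_coeff_sums:
  assumes "g holomorphic_on ball 0 1" "cmod z < 1"
  shows "(\<lambda>n. taylor_coeff g n * z ^ n) sums g z"
  using holomorphic_power_series[OF assms(1), of z] assms(2) by (simp add: taylor_coeff_def)

lemma taylor_coeff_cong:
  assumes "g holomorphic_on ball 0 1" "\<And>z. z \<in> ball 0 1 \<Longrightarrow> g z = h z"
  shows "taylor_coeff g = taylor_coeff h"
proof
  fix n
  have "h holomorphic_on ball 0 1"
    using assms holomorphic_transform by blast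
  then show "taylor_coeff g n = taylor_coeff h n"
    using higher_deriv_transform_within_open[of g "ball 0 1" h 0 n] assms
    by (simp add: taylor_coeff_def)
qed

lemma taylor_coeff_mult:
  assumes "g holomorphic_on ball 0 1" "h holomorphic_on ball 0 1"
  shows "taylor_coeff (\<lambda>z. g z * h z) n = (\<Sum>k\<le>n. taylor_coeff g k * taylor_coeff h (n - k))"
proof -
  have "taylor_coeff (\<lambda>z. g z * h z) n =
      (\<Sum>k=0..n. of_nat (n choose k) * (deriv ^^ k) g 0 * (deriv ^^ (n - k)) h 0) / fact n"
    using higher_deriv_mult[OF assms, of 0 n] by (simp add: taylor_coeff_def)
  also have "\<dots> = (\<Sum>k=0..n. taylor_coeff g k * taylor_coeff h (n - k))"
    unfolding sum_divide_distrib
    by (intro sum.cong refl) (simp add: taylor_coeff_def binomial_fact field_simps)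
  finally show ?thesis by (simp add: atLeast0AtMost)
qed

lemma taylor_coeff_deriv:
  "taylor_coeff (deriv h) n = of_nat (Suc n) * taylor_coeff h (Suc n)"
proof -
  have "complex_of_nat (fact (Suc n)) = of_nat (Suc n) * of_nat (fact n)"
    by (simp only: fact_Suc of_nat_mult of_nat_id)
  then show ?thesis
    unfolding taylor_coeff_def by (simp add: funpow_swap1 del: of_nat_Suc fact_Suc of_nat_fact)
qed

text \<open>With the Cauchy product read as multiplication of formal power series, multiplicativity
  in the symbol becomes associativity.\<close>

lemma toeplitz_eq_fps_mult:
  "toeplitz g a = fps_nth (Abs_fps (taylor_coeff g) * Abs_fps a)"
  by (simp add: fun_eq_iff toeplitz_def fps_mult_nth atLeast0AtMost)

lemma toeplitz_mult:
  assumes "g holomorphic_on ball 0 1" "h holomorphic_on ball 0 1"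
  shows "toeplitz (\<lambda>z. g z * h z) a = toeplitz g (toeplitz h a)"
proof -
  have "Abs_fps (taylor_coeff (\<lambda>z. g z * h z)) = Abs_fps (taylor_coeff g) * Abs_fps (taylor_coeff h)"
    using taylor_coeff_mult[OF assms] by (simp add: fps_eq_iff fps_mult_nth atLeast0AtMost)
  then show ?thesis by (simp add: toeplitz_eq_fps_mult fps_nth_inverse mult.assoc)
qed

lemma toeplitz_cong:
  assumes "g holomorphic_on ball 0 1" "\<And>z. z \<in> ball 0 1 \<Longrightarrow> g z = h z"
  shows "toeplitz g a = toeplitz h a"
  using taylor_coeff_cong[OF assms] by (simp add: toeplitz_def)

section \<open>Boundedness of analytic Toeplitz operators on \<open>H2\<close>\<close>

lemma H2_summable_powser:
  assumes "a \<in> H2" "cmod z < 1"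
  shows "summable (\<lambda>n. cmod (a n * z ^ n))"
proof -
  \<comment> \<open>The powers of \<open>cnj z\<close> form the reproducing kernel sequence; pairing
    with it gives the power series.\<close>
  have "summable (\<lambda>n. ((cmod z)\<^sup>2) ^ n)"
    using assms(2) by (intro summable_geometric) (simp add: power_less_one_iff abs_square_less_1)
  then have "(\<lambda>n. cnj z ^ n) \<in> H2"
    by (simp add: H2_def norm_power power_mult[symmetric] mult.commute)
  from summable_h2_inner[OF assms(1) this] show ?thesis by simp
qed

text \<open>On a circle of radius \<open>r < 1\<close> the product function is pointwise at most
  \<open>M\<close> times the original one. Parseval turns this into an inequality between weighted
  coefficient sums, and \<open>r\<close> then tends to \<open>1\<close>.\<close>

lemma toeplitz_bounded:
  assumes hol: "g holomorphic_on ball 0 1" and M: "\<And>z. cmod z < 1 \<Longrightarrow> cmod (g z) \<le> M"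
    and a: "a \<in> H2"
  shows toeplitz_in_H2: "toeplitz g a \<in> H2"
    and h2_norm_toeplitz_le: "h2_norm (toeplitz g a) \<le> M * h2_norm a"
proof -
  have M0: "M \<ge> 0" using order_trans[OF norm_ge_zero M[of 0]] by simp
  define A where "A z = (\<Sum>n. a n * z ^ n)" for z
  let ?b = "toeplitz g a"
  have product: "(\<lambda>n. ?b n * z ^ n) sums (g z * A z)" if z: "cmod z < 1" for z
  proof -
    \<comment> \<open>Convergence at the larger radius \<open>r\<close> yields the absolute
      convergence at \<open>z\<close> that the Cauchy product needs.\<close>
    obtain r where r: "cmod z < r" "r < 1" using dense[OF z] by blast
    have "\<bar>r\<bar> < 1" using r order_le_less_trans[OF norm_ge_zero r(1)] by simp
    then have "summable (\<lambda>n. cmod (taylor_coeff g n * z ^ n))"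
      using taylor_coeff_sums[OF hol, of "of_real r"] r
      by (intro powser_insidea[of _ "of_real r"]) (auto simp: sums_iff)
    from Cauchy_product_sums[OF this H2_summable_powser[OF a z]]
    have "(\<lambda>n. \<Sum>i\<le>n. taylor_coeff g i * z ^ i * (a (n - i) * z ^ (n - i))) sums
        ((\<Sum>n. taylor_coeff g n * z ^ n) * A z)" by (simp add: A_def)
    moreover have "(\<Sum>i\<le>n. taylor_coeff g i * z ^ i * (a (n - i) * z ^ (n - i))) = ?b n * z ^ n" for n
      unfolding toeplitz_def sum_distrib_right
      by (intro sum.cong refl) (simp add: mult_ac flip: power_add)
    ultimately show ?thesis
      using taylor_coeff_sums[OF hol z] by (simp add: sums_iff)
  qed
  have radius: "(\<Sum>n<N. (cmod (?b n) * r ^ n)\<^sup>2) \<le> (M * h2_norm a)\<^sup>2" if r: "0 \<le> r" "r < 1" for r N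
  proof -
    have z: "cmod (of_real r * cis t) < 1" for t using r by (simp add: norm_mult)
    have pow: "d n * of_real r ^ n * cis (real n * t) = d n * (of_real r * cis t) ^ n" for d :: "nat \<Rightarrow> complex" and n t
      by (simp only: power_mult_distrib Complex.DeMoivre mult.assoc)
    obtain r' where r': "r < r'" "r' < 1" using dense[OF r(2)] by blast
    have "summable (\<lambda>n. cmod (?b n * of_real r ^ n))"
      using product[of "of_real r'"] r r'
      by (intro powser_insidea[of _ "of_real r'"]) (auto simp: sums_iff)
    from parseval_circle[OF this]
    have sb: "summable (\<lambda>n. (cmod (?b n) * r ^ n)\<^sup>2)"
      and Ib: "((\<lambda>t. (cmod (g (of_real r * cis t) * A (of_real r * cis t)))\<^sup>2) has_integral
        2 * pi * (\<Sum>n. (cmod (?b n) * r ^ n)\<^sup>2)) {0..2*pi}"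
      using product[OF z] r by (simp_all add: pow norm_mult norm_power sums_iff)
    have "summable (\<lambda>n. cmod (a n * of_real r ^ n))"
      using H2_summable_powser[OF a, of "of_real r"] r by simp
    from parseval_circle[OF this]
    have sa: "summable (\<lambda>n. (cmod (a n) * r ^ n)\<^sup>2)"
      and Ia: "((\<lambda>t. (cmod (A (of_real r * cis t)))\<^sup>2) has_integral
        2 * pi * (\<Sum>n. (cmod (a n) * r ^ n)\<^sup>2)) {0..2*pi}"
      using r by (simp_all add: pow norm_mult norm_power A_def)
    have "2 * pi * (\<Sum>n. (cmod (?b n) * r ^ n)\<^sup>2) \<le> M\<^sup>2 * (2 * pi * (\<Sum>n. (cmod (a n) * r ^ n)\<^sup>2))"
    proof (rule has_integral_le[OF Ib has_integral_mult_right[OF Ia]])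
      fix t :: real
      have "cmod (g (of_real r * cis t)) \<le> M" using M[OF z] .
      then show "(cmod (g (of_real r * cis t) * A (of_real r * cis t)))\<^sup>2 \<le> M\<^sup>2 * (cmod (A (of_real r * cis t)))\<^sup>2"
        by (auto simp: norm_mult power_mult_distrib intro!: mult_right_mono power_mono)
    qed
    then have "(\<Sum>n. (cmod (?b n) * r ^ n)\<^sup>2) \<le> M\<^sup>2 * (\<Sum>n. (cmod (a n) * r ^ n)\<^sup>2)"
      by (simp add: mult.left_commute)
    also have "\<dots> \<le> M\<^sup>2 * (\<Sum>n. (cmod (a n))\<^sup>2)"
    proof (intro mult_left_mono suminf_le sa)
      show "(cmod (a n) * r ^ n)\<^sup>2 \<le> (cmod (a n))\<^sup>2" for n
        using r by (intro power_mono mult_left_le) (auto simp: power_le_one)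
    qed (use a in \<open>auto simp: H2_def\<close>)
    also have "\<dots> = (M * h2_norm a)\<^sup>2"
      using a by (auto simp: power_mult_distrib h2_norm_def H2_def suminf_nonneg)
    finally have "(\<Sum>n. (cmod (?b n) * r ^ n)\<^sup>2) \<le> (M * h2_norm a)\<^sup>2" .
    moreover have "(\<Sum>n<N. (cmod (?b n) * r ^ n)\<^sup>2) \<le> (\<Sum>n. (cmod (?b n) * r ^ n)\<^sup>2)"
      using sb by (rule sum_le_suminf) auto
    ultimately show ?thesis by linarith
  qed
  \<comment> \<open>The limit in \<open>r\<close> is taken for fixed \<open>N\<close>, where the sum
    is finite and continuous in \<open>r\<close>.\<close>
  have bound: "(\<Sum>n<N. (cmod (?b n))\<^sup>2) \<le> (M * h2_norm a)\<^sup>2" for N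
  proof (rule tendsto_upperbound)
    have "((\<lambda>r. \<Sum>n<N. (cmod (?b n) * r ^ n)\<^sup>2) \<longlongrightarrow> (\<Sum>n<N. (cmod (?b n) * 1 ^ n)\<^sup>2)) (at_left 1)"
      by (intro tendsto_intros)
    then show "((\<lambda>r. \<Sum>n<N. (cmod (?b n) * r ^ n)\<^sup>2) \<longlongrightarrow> (\<Sum>n<N. (cmod (?b n))\<^sup>2)) (at_left 1)"
      by simp
    have "eventually (\<lambda>r. r \<in> {0<..<1::real}) (at_left 1)"
      by (rule eventually_at_left_real) simp
    then show "eventually (\<lambda>r. (\<Sum>n<N. (cmod (?b n) * r ^ n)\<^sup>2) \<le> (M * h2_norm a)\<^sup>2) (at_left 1)"
      by eventually_elim (use radius in auto)
  qed simp
  show "toeplitz g a \<in> H2" "h2_norm (toeplitz g a) \<le> M * h2_norm a"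
    using H2_memI_bounded[OF bound] M0 a h2_norm_nonneg by auto
qed

section \<open>The adjoint and its powers\<close>

lemma Hinf_bound:
  assumes "g \<in> Hinf"
  obtains M where "\<And>z. cmod z < 1 \<Longrightarrow> cmod (g z) \<le> M"
  using assms unfolding Hinf_def bounded_iff by force

text \<open>Riesz representation by hand: the unit vectors \<open>e m\<close> force the coordinates
  of the representing vector, and boundedness of the operator puts that vector in \<open>H2\<close>.
  Existence and uniqueness together show that the definite description yields the actual
  adjoint.\<close>

lemma toeplitz_adj:
  assumes g: "g \<in> Hinf" and b: "b \<in> H2"
  shows toeplitz_adj_in_H2: "toeplitz_adj g b \<in> H2"
    and h2_inner_toeplitz: "a \<in> H2 \<Longrightarrow> h2_inner (toeplitz g a) b = h2_inner a (toeplitz_adj g b)"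
proof -
  obtain M where M: "\<And>z. cmod z < 1 \<Longrightarrow> cmod (g z) \<le> M" using Hinf_bound[OF g] by blast
  have M0: "M \<ge> 0" using order_trans[OF norm_ge_zero M[of 0]] by simp
  have hol: "g holomorphic_on ball 0 1" using g by (simp add: Hinf_def)
  note T = toeplitz_bounded[OF hol M]
  define e :: "nat \<Rightarrow> nat \<Rightarrow> complex" where "e m n = (if n = m then 1 else 0)" for m n
  have e: "e m \<in> H2" for m by (rule H2_finite_support(1)[of "Suc m"]) (auto simp: e_def)
  define c where "c m = cnj (h2_inner (toeplitz g (e m)) b)" for m
  define p where "p N a n = (if n < N then a n else 0)" for N :: nat and a :: "nat \<Rightarrow> complex" and n
  have p: "p N a \<in> H2" for N a by (rule H2_finite_support(1)[of N]) (auto simp: p_def)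
  have add: "h2_inner (toeplitz g (\<lambda>n. x n + y n)) b = h2_inner (toeplitz g x) b + h2_inner (toeplitz g y) b"
    if "x \<in> H2" "y \<in> H2" for x y
  proof -
    have "(\<lambda>n. toeplitz g x n * cnj (b n) + toeplitz g y n * cnj (b n)) sums
        (h2_inner (toeplitz g x) b + h2_inner (toeplitz g y) b)"
      using that b T(1) by (intro sums_add h2_inner_sums) auto
    moreover have "toeplitz g x n * cnj (b n) + toeplitz g y n * cnj (b n) =
        toeplitz g (\<lambda>n. x n + y n) n * cnj (b n)" for n
      by (simp add: toeplitz_def algebra_simps sum.distrib)
    ultimately show ?thesis by (simp add: h2_inner_def sums_iff)
  qed
  have scale: "h2_inner (toeplitz g (\<lambda>n. k * x n)) b = k * h2_inner (toeplitz g x) b"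
    if "x \<in> H2" for x k
  proof -
    have "(\<lambda>n. k * (toeplitz g x n * cnj (b n))) sums (k * h2_inner (toeplitz g x) b)"
      using that b T(1) by (intro sums_mult h2_inner_sums) auto
    moreover have "k * (toeplitz g x n * cnj (b n)) = toeplitz g (\<lambda>n. k * x n) n * cnj (b n)" for n
      by (simp add: toeplitz_def sum_distrib_left sum_distrib_right mult_ac)
    ultimately show ?thesis by (simp add: h2_inner_def sums_iff)
  qed
  have finite: "h2_inner (toeplitz g (p N a)) b = (\<Sum>n<N. a n * cnj (c n))" for N a
  proof (induction N)
    case 0
    then show ?case by (simp add: p_def toeplitz_def h2_inner_def)
  next
    case (Suc N)
    have "p (Suc N) a = (\<lambda>n. p N a n + a N * e N n)"
      by (auto simp: p_def e_def less_Suc_eq)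
    moreover have "(\<lambda>n. a N * e N n) \<in> H2"
      by (rule H2_finite_support(1)[of "Suc N"]) (auto simp: e_def)
    ultimately show ?case
      using Suc by (simp add: add[OF p] scale[OF e] c_def)
  qed
  have c: "c \<in> H2"
  proof (rule H2_memI_bounded(1))
    fix N
    \<comment> \<open>Testing the functional on the truncation \<open>p N c\<close> returns
      \<open>s\<close>, whence \<open>s \<le> M * sqrt s * h2_norm b\<close>. Cancelling
      \<open>sqrt s\<close> bounds the partial sums independently of \<open>N\<close>.\<close>
    define s where "s = (\<Sum>n<N. (cmod (c n))\<^sup>2)"
    have s: "s \<ge> 0" by (simp add: s_def sum_nonneg)
    have norm_p: "h2_norm (p N c) = sqrt s"
    proof -
      have "(h2_norm (p N c))\<^sup>2 = (\<Sum>n<N. (cmod (p N c n))\<^sup>2)"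
        by (rule H2_finite_support(2)) (auto simp: p_def)
      also have "\<dots> = s" unfolding s_def by (rule sum.cong) (auto simp: p_def)
      finally show ?thesis using h2_norm_nonneg[OF p, of N c] real_sqrt_unique by metis
    qed
    have "complex_of_real s = h2_inner (toeplitz g (p N c)) b"
      by (simp add: s_def finite flip: complex_norm_square)
    then have "s = cmod (h2_inner (toeplitz g (p N c)) b)"
      using s by (metis abs_of_nonneg norm_of_real)
    also have "\<dots> \<le> h2_norm (toeplitz g (p N c)) * h2_norm b"
      using T(1) p b by (intro norm_h2_inner_le) auto
    also have "\<dots> \<le> M * sqrt s * h2_norm b"
      using T(2)[of "p N c"] p h2_norm_nonneg[OF b] by (intro mult_right_mono) (auto simp: norm_p)
    finally have le: "sqrt s * sqrt s \<le> sqrt s * (M * h2_norm b)" using s by (simp add: mult_ac)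
    have "sqrt s \<le> M * h2_norm b"
    proof (cases "s = 0")
      case True
      then show ?thesis using M0 h2_norm_nonneg[OF b] by simp
    next
      case False
      then have "0 < sqrt s" using s by simp
      from mult_left_le_imp_le[OF le this] show ?thesis .
    qed
    then have "(sqrt s)\<^sup>2 \<le> (M * h2_norm b)\<^sup>2" using s by (intro power_mono) auto
    then show "(\<Sum>n<N. (cmod (c n))\<^sup>2) \<le> (M * h2_norm b)\<^sup>2" using s by (simp add: s_def)
  qed (use M0 h2_norm_nonneg[OF b] in simp)
  have adj: "h2_inner (toeplitz g a) b = h2_inner a c" if a: "a \<in> H2" for a
  proof -
    \<comment> \<open>The identity is known on truncations; the error is the functional on the tail
      of \<open>a\<close>, whose norm tends to \<open>0\<close>.\<close>
    have "(\<lambda>N. \<Sum>n<N. a n * cnj (c n)) \<longlonglongrightarrow> h2_inner (toeplitz g a) b"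
    proof (rule LIM_zero_cancel, rule Lim_null_comparison)
      have "((\<lambda>N. M * h2_norm (h2_tail N a) * h2_norm b) \<longlonglongrightarrow> M * 0 * h2_norm b)"
        by (intro tendsto_intros h2_tail_tendsto_0 a)
      then show "((\<lambda>N. M * h2_norm (h2_tail N a) * h2_norm b) \<longlonglongrightarrow> 0)" by simp
      show "\<forall>\<^sub>F N in sequentially. cmod ((\<Sum>n<N. a n * cnj (c n)) - h2_inner (toeplitz g a) b)
          \<le> M * h2_norm (h2_tail N a) * h2_norm b"
      proof (intro always_eventually allI)
        fix N
        note tail = h2_tail_in_H2[OF a, of N]
        have "a = (\<lambda>n. p N a n + h2_tail N a n)" by (auto simp: p_def h2_tail_def)
        with add[OF p tail, of N a]
        have "h2_inner (toeplitz g a) b = (\<Sum>n<N. a n * cnj (c n)) + h2_inner (toeplitz g (h2_tail N a)) b"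
          by (simp add: finite)
        then have "cmod ((\<Sum>n<N. a n * cnj (c n)) - h2_inner (toeplitz g a) b) =
            cmod (h2_inner (toeplitz g (h2_tail N a)) b)" by simp
        also have "\<dots> \<le> h2_norm (toeplitz g (h2_tail N a)) * h2_norm b"
          using T(1) tail b by (intro norm_h2_inner_le) auto
        also have "\<dots> \<le> M * h2_norm (h2_tail N a) * h2_norm b"
          using T(2) tail h2_norm_nonneg[OF b] by (intro mult_right_mono) auto
        finally show "cmod ((\<Sum>n<N. a n * cnj (c n)) - h2_inner (toeplitz g a) b)
          \<le> M * h2_norm (h2_tail N a) * h2_norm b" .
      qed
    qed
    then show ?thesis
      unfolding h2_inner_def[of a c] using sums_def sums_unique by blast
  qed
  have "toeplitz_adj g b = c"
    unfolding toeplitz_adj_def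
  proof (rule the_equality)
    show "c \<in> H2 \<and> (\<forall>a\<in>H2. h2_inner (toeplitz g a) b = h2_inner a c)" using c adj by blast
    fix d assume d: "d \<in> H2 \<and> (\<forall>a\<in>H2. h2_inner (toeplitz g a) b = h2_inner a d)"
    \<comment> \<open>Pairing with unit vectors reads off coordinates, which gives
      uniqueness.\<close>
    have inner_e: "h2_inner (e m) x = cnj (x m)" for m x
    proof -
      have "(\<lambda>n. e m n * cnj (x n)) sums (\<Sum>n\<in>{m}. e m n * cnj (x n))"
        by (intro sums_finite) (auto simp: e_def)
      then show ?thesis by (simp add: h2_inner_def sums_iff e_def)
    qed
    show "d = c"
    proof
      fix m
      have "h2_inner (e m) d = h2_inner (e m) c" using d adj e by metis
      then show "d m = c m" by (simp add: inner_e)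
    qed
  qed
  with c adj show "toeplitz_adj g b \<in> H2"
    and "a \<in> H2 \<Longrightarrow> h2_inner (toeplitz g a) b = h2_inner a (toeplitz_adj g b)" by auto
qed

text \<open>The outermost factor \<open>g\<close> crosses to the other side, so the induction
  hypothesis is needed at \<open>toeplitz_adj g b\<close>. The spare factor \<open>h\<close> will
  absorb the fractional part of a real exponent and a unimodular constant.\<close>

lemma h2_inner_toeplitz_power:
  assumes g: "g \<in> Hinf" and h: "h \<in> Hinf" and a: "a \<in> H2" and b: "b \<in> H2"
  shows "h2_inner (toeplitz (\<lambda>z. h z * g z ^ n) a) b = h2_inner (toeplitz h a) ((toeplitz_adj g ^^ n) b)"
  using b
proof (induction n arbitrary: b)
  case 0
  then show ?case by simp
next
  case (Suc n)
  have hol: "g holomorphic_on ball 0 1" "h holomorphic_on ball 0 1" using g h by (auto simp: Hinf_def)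
  obtain M N where M: "\<And>z. cmod z < 1 \<Longrightarrow> cmod (g z) \<le> M"
    and N: "\<And>z. cmod z < 1 \<Longrightarrow> cmod (h z) \<le> N"
    using Hinf_bound[OF g] Hinf_bound[OF h] by metis
  have hg: "(\<lambda>z. h z * g z ^ n) holomorphic_on ball 0 1" by (intro holomorphic_intros hol)
  have "cmod (h z * g z ^ n) \<le> N * M ^ n" if "cmod z < 1" for z
    using M[OF that] N[OF that] order_trans[OF norm_ge_zero N[OF that]]
    by (auto simp: norm_mult norm_power intro!: mult_mono power_mono)
  note in_H2 = toeplitz_in_H2[OF hg this a]
  have "toeplitz (\<lambda>z. h z * g z ^ Suc n) a = toeplitz (\<lambda>z. g z * (h z * g z ^ n)) a"
    by (simp add: mult_ac)
  also have "\<dots> = toeplitz g (toeplitz (\<lambda>z. h z * g z ^ n) a)"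
    by (rule toeplitz_mult[OF hol(1) hg])
  finally have "h2_inner (toeplitz (\<lambda>z. h z * g z ^ Suc n) a) b =
      h2_inner (toeplitz (\<lambda>z. h z * g z ^ n) a) (toeplitz_adj g b)"
    using h2_inner_toeplitz[OF g Suc.prems in_H2] by simp
  also have "\<dots> = h2_inner (toeplitz h a) ((toeplitz_adj g ^^ Suc n) b)"
    using Suc.IH[OF toeplitz_adj_in_H2[OF g Suc.prems]] by (simp add: funpow_swap1)
  finally show ?case .
qed

lemma toeplitz_adj_power_in_H2:
  assumes "g \<in> Hinf" "b \<in> H2"
  shows "(toeplitz_adj g ^^ n) b \<in> H2"
  using assms by (induction n) (auto simp: toeplitz_adj_in_H2)

subsection \<open>A Phragmen-Lindelof argument\<close>

text \<open>The substitution \<open>z = exp w\<close> turns the sector into a horizontal strip, where the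
  damping factor \<open>exp (- \<eta> * exp (\<alpha> * (w - \<i> * m)))\<close> with
  \<open>1 < \<alpha> < pi / (b - a)\<close> beats the exponential growth of \<open>F\<close>.\<close>

lemma phragmen_lindelof_sector:
  fixes F :: "complex \<Rightarrow> complex"
  assumes ab: "a < b" "b - a < pi"
    and S: "open S" "F holomorphic_on S"
    and sector: "\<And>r \<theta>. \<lbrakk>0 \<le> r; a \<le> \<theta>; \<theta> \<le> b\<rbrakk> \<Longrightarrow> of_real r * cis \<theta> \<in> S"
    and growth: "\<And>r \<theta>. \<lbrakk>0 \<le> r; a \<le> \<theta>; \<theta> \<le> b\<rbrakk> \<Longrightarrow> cmod (F (of_real r * cis \<theta>)) \<le> A * exp (B * r)"
    and ray_a: "\<And>r. 0 \<le> r \<Longrightarrow> cmod (F (of_real r * cis a)) \<le> M"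
    and ray_b: "\<And>r. 0 \<le> r \<Longrightarrow> cmod (F (of_real r * cis b)) \<le> M"
    and r: "0 \<le> r" and \<theta>: "a \<le> \<theta>" "\<theta> \<le> b"
  shows "cmod (F (of_real r * cis \<theta>)) \<le> M"
proof (cases "r = 0")
  case True
  then show ?thesis using ray_a[of 0] by simp
next
  case False
  with r have "r > 0" by simp
  define m \<beta> where "m = (a + b) / 2" and "\<beta> = (b - a) / 2"
  have \<beta>: "\<beta> > 0" "\<beta> < pi / 2" using ab by (auto simp: \<beta>_def)
  \<comment> \<open>The mean of \<open>1\<close> and \<open>pi / (2 * \<beta>)\<close>: above
    \<open>1\<close>, so that the damping outgrows exponential type, yet with
    \<open>\<alpha> * \<beta> < pi / 2\<close>, so that the cosine stays positive across the
    strip.\<close>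
  define \<alpha> where "\<alpha> = (1 + pi / (2 * \<beta>)) / 2"
  have \<alpha>: "\<alpha> > 1" "\<alpha> * \<beta> < pi / 2" using \<beta> by (auto simp: \<alpha>_def field_simps)
  define \<kappa> where "\<kappa> = cos (\<alpha> * \<beta>)"
  have \<kappa>: "\<kappa> > 0" unfolding \<kappa>_def using \<alpha> \<beta> by (intro cos_gt_zero_pi) (auto intro: less_trans[of _ 0])
  have exp_eq: "exp w = of_real (exp (Re w)) * cis (Im w)" for w
    by (simp add: exp_eq_polar)
  define E where "E w = exp (of_real \<alpha> * (w - \<i> * of_real m))" for w :: complex
  have Re_E: "Re (E w) \<ge> \<kappa> * exp (\<alpha> * Re w)" if "a \<le> Im w" "Im w \<le> b" for w
  proof -
    have "\<bar>Im w - m\<bar> \<le> \<beta>" using that by (simp add: m_def \<beta>_def abs_le_iff field_simps)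
    then have "\<bar>\<alpha> * (Im w - m)\<bar> \<le> \<alpha> * \<beta>" using \<alpha> by (simp add: abs_mult)
    then have "cos (\<alpha> * \<beta>) \<le> cos \<bar>\<alpha> * (Im w - m)\<bar>"
      using \<alpha> by (intro cos_monotone_0_pi_le) auto
    then show ?thesis by (simp add: E_def Re_exp \<kappa>_def mult.commute)
  qed
  define w0 where "w0 = Complex (ln r) \<theta>"
  have w0: "exp w0 = of_real r * cis \<theta>" using \<open>r > 0\<close> by (simp add: w0_def exp_eq)
  have damped: "cmod (F (exp w0) * exp (- of_real \<eta> * E w0)) \<le> M + \<mu>"
    if \<eta>: "\<eta> > 0" and \<mu>: "\<mu> > 0" for \<eta> \<mu> :: real
  proof -
    define G where "G w = F (exp w) * exp (- of_real \<eta> * E w)" for w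
    have G_le: "cmod (G w) \<le> cmod (F (exp w)) * exp (- (\<eta> * \<kappa> * exp (\<alpha> * Re w)))"
      if "a \<le> Im w" "Im w \<le> b" for w
      using Re_E[OF that] \<eta> by (auto simp: G_def norm_mult mult.assoc intro!: mult_left_mono)
    have G_le': "cmod (G w) \<le> cmod (F (exp w))" if "a \<le> Im w" "Im w \<le> b" for w
      using \<eta> \<kappa> by (intro order_trans[OF G_le[OF that]] mult_left_le) auto
    \<comment> \<open>The strip is unbounded to the left, where \<open>exp w\<close> tends to
      \<open>0\<close>. Continuity at the vertex, with \<open>ray_a\<close> at \<open>0\<close>,
      controls the left edge up to the slack \<open>\<mu>\<close>.\<close>
    have "0 \<in> S" using sector[of 0 a] ab by simp
    then have "isCont F 0"
      using S holomorphic_on_imp_continuous_on continuous_on_eq_continuous_at by blast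
    then have "(F \<longlongrightarrow> F 0) (nhds 0)" unfolding isCont_def tendsto_at_iff_tendsto_nhds .
    then have "eventually (\<lambda>z. cmod (F z) < M + \<mu>) (nhds 0)"
      using ray_a[of 0] \<mu> by (intro order_tendstoD(2)[OF tendsto_norm]) auto
    then obtain d where d: "d > 0" "\<And>z. cmod z < d \<Longrightarrow> cmod (F z) < M + \<mu>"
      unfolding eventually_nhds_metric by auto
    \<comment> \<open>On the right edge this is the growth bound times the damping, with
      \<open>exp R\<close> factored out of the exponent; \<open>\<alpha> > 1\<close> drives that
      exponent to minus infinity.\<close>
    have "((\<lambda>R. A * exp (exp R * (B - \<eta> * \<kappa> * exp ((\<alpha> - 1) * R)))) \<longlongrightarrow> A * 0) at_top"
    proof (intro tendsto_mult tendsto_const filterlim_compose[OF exp_at_bot])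
      have "filterlim (\<lambda>R. exp ((\<alpha> - 1) * R)) at_top at_top"
        using \<alpha> by (intro filterlim_compose[OF exp_at_top] filterlim_tendsto_pos_mult_at_top[OF tendsto_const] filterlim_ident) auto
      then have "filterlim (\<lambda>R. - B + \<eta> * \<kappa> * exp ((\<alpha> - 1) * R)) at_top at_top"
        using \<eta> \<kappa>
        by (intro filterlim_tendsto_add_at_top[OF tendsto_const] filterlim_tendsto_pos_mult_at_top[OF tendsto_const]) auto
      then have "filterlim (\<lambda>R. exp R * (- B + \<eta> * \<kappa> * exp ((\<alpha> - 1) * R))) at_top at_top"
        by (intro filterlim_at_top_mult_at_top exp_at_top)
      moreover have "exp R * (- B + \<eta> * \<kappa> * exp ((\<alpha> - 1) * R)) = - (exp R * (B - \<eta> * \<kappa> * exp ((\<alpha> - 1) * R)))" for R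
        by (simp add: algebra_simps)
      ultimately show "filterlim (\<lambda>R. exp R * (B - \<eta> * \<kappa> * exp ((\<alpha> - 1) * R))) at_bot at_top"
        by (simp add: filterlim_uminus_at_bot)
    qed
    moreover have "M + \<mu> > 0" using order_trans[OF norm_ge_zero ray_a[of 0]] \<mu> by simp
    ultimately have "eventually (\<lambda>R. A * exp (exp R * (B - \<eta> * \<kappa> * exp ((\<alpha> - 1) * R))) < M + \<mu>) at_top"
      by (intro order_tendstoD(2)) auto
    then have "eventually (\<lambda>R. A * exp (exp R * (B - \<eta> * \<kappa> * exp ((\<alpha> - 1) * R))) < M + \<mu> \<and> R \<ge> ln r) at_top"
      using eventually_ge_at_top by (rule eventually_conj)
    from eventually_happens'[OF trivial_limit_at_top_linorder this]
    obtain R where R: "A * exp (exp R * (B - \<eta> * \<kappa> * exp ((\<alpha> - 1) * R))) < M + \<mu>" "R \<ge> ln r"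
      by blast
    \<comment> \<open>Far enough left for \<open>exp L < d\<close>, and at most \<open>ln r\<close>
      so that \<open>w0\<close> lies in the rectangle.\<close>
    define L where "L = min (ln r) (ln (d / 2))"
    have L: "L \<le> ln r" by (simp add: L_def)
    have "exp L \<le> exp (ln (d/2))" unfolding L_def exp_le_cancel_iff by (rule min.cobounded2)
    then have L_d: "exp L < d" using d(1) by simp
    have exp_in_S: "exp w \<in> S" if "a \<le> Im w" "Im w \<le> b" for w
      using sector[of "exp (Re w)" "Im w"] that by (simp add: exp_eq)
    let ?Q = "cbox (Complex L a) (Complex R b)"
    have holG: "G holomorphic_on ?Q"
      unfolding G_def E_def
      by (intro holomorphic_intros holomorphic_on_compose_gen[OF _ S(2), unfolded o_def])
         (auto simp: in_cbox_complex_iff intro: exp_in_S)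
    have "cmod (G w0) \<le> M + \<mu>"
    proof (rule maximum_modulus_frontier[of G ?Q])
      show "G holomorphic_on interior ?Q" using holG interior_subset holomorphic_on_subset by blast
      show "continuous_on (closure ?Q) G" using holG by (simp add: holomorphic_on_imp_continuous_on)
      show "w0 \<in> ?Q" using \<theta> L R by (simp add: in_cbox_complex_iff w0_def)
      fix w assume "w \<in> frontier ?Q"
      then have w: "L \<le> Re w" "Re w \<le> R" "a \<le> Im w" "Im w \<le> b"
        and "Re w = L \<or> Re w = R \<or> Im w = a \<or> Im w = b"
        by (auto simp: frontier_cbox in_cbox_complex_iff in_box_complex_iff)
      then consider "Re w = L" | "Re w = R" | "Im w = a" | "Im w = b" by blast
      then show "cmod (G w) \<le> M + \<mu>"
      proof cases
        case 1
        then have "cmod (exp w) < d" using L_d by simp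
        then show ?thesis using d(2) G_le'[OF w(3,4)] by (meson less_eq_real_def order_trans)
      next
        case 2
        have "cmod (G w) \<le> (A * exp (B * exp R)) * exp (- (\<eta> * \<kappa> * exp (\<alpha> * R)))"
          using growth[of "exp (Re w)" "Im w"] w 2
          by (intro order_trans[OF G_le[OF w(3,4)]]) (auto simp: exp_eq intro!: mult_right_mono)
        also have "\<dots> = A * exp (exp R * (B - \<eta> * \<kappa> * exp ((\<alpha> - 1) * R)))"
          by (simp add: algebra_simps flip: exp_add)
        finally show ?thesis using R by simp
      next
        case 3
        then show ?thesis using G_le'[OF w(3,4)] ray_a[of "exp (Re w)"] \<mu> by (simp add: exp_eq)
      next
        case 4
        then show ?thesis using G_le'[OF w(3,4)] ray_b[of "exp (Re w)"] \<mu> by (simp add: exp_eq)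
      qed
    qed simp
    then show ?thesis by (simp add: G_def)
  qed
  \<comment> \<open>At the fixed point \<open>w0\<close> the damping factor tends to
    \<open>1\<close> as \<open>\<eta>\<close> tends to \<open>0\<close>; the slack
    \<open>\<mu>\<close> is removed afterwards.\<close>
  have "cmod (F (exp w0)) \<le> M + \<mu>" if "\<mu> > 0" for \<mu>
  proof (rule tendsto_upperbound)
    have "((\<lambda>\<eta>. cmod (F (exp w0) * exp (- of_real \<eta> * E w0))) \<longlongrightarrow>
        cmod (F (exp w0) * exp (- of_real 0 * E w0))) (at_right 0)"
      by (intro tendsto_intros)
    then show "((\<lambda>\<eta>. cmod (F (exp w0) * exp (- of_real \<eta> * E w0))) \<longlongrightarrow> cmod (F (exp w0))) (at_right 0)"
      by simp
    show "\<forall>\<^sub>F \<eta> in at_right 0. cmod (F (exp w0) * exp (- of_real \<eta> * E w0)) \<le> M + \<mu>"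
      using eventually_at_right_less[of 0] by eventually_elim (use damped that in auto)
  qed simp
  then show ?thesis unfolding w0 by (rule field_le_epsilon)
qed

text \<open>Exponential type admits only sectors of opening below \<open>pi\<close>, so the sector
  ends at the angle \<open>pi - \<delta>\<close>, near enough to the negative half-line for
  \<open>neg\<close> to apply on that ray. The loss \<open>\<epsilon>\<close> vanishes in a final
  limit.\<close>

lemma entire_upper_half_plane_bound:
  assumes hol: "\<phi> holomorphic_on UNIV"
    and growth: "\<And>t. cmod (\<phi> t) \<le> A * exp (B * cmod t)"
    and pos: "\<And>x. 0 \<le> x \<Longrightarrow> cmod (\<phi> (of_real x)) \<le> C * (1 + x) ^ K"
    and neg: "\<And>\<epsilon>. \<epsilon> > 0 \<Longrightarrow> \<exists>M. \<forall>s \<tau>. 0 \<le> s \<and> M * \<bar>\<tau>\<bar> \<le> s \<longrightarrow> cmod (\<phi> (Complex (-s) \<tau>)) \<le> D * exp (\<epsilon> * \<bar>\<tau>\<bar>)"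
    and t: "Im t > 0"
  shows "cmod (\<phi> t) \<le> max (C * 2 ^ K) D * (1 + cmod t) ^ K"
proof -
  let ?M0 = "max (C * 2 ^ K) D"
  have C: "C \<ge> 0" using order_trans[OF norm_ge_zero pos[of 0]] by simp
  have \<theta>: "0 < Arg t" "Arg t < pi" using t Arg_lt_pi by blast+
  have bound: "cmod (\<phi> t) \<le> ?M0 * cmod (t + \<i>) ^ K * exp (\<epsilon> * Im t)" if \<epsilon>: "\<epsilon> > 0" for \<epsilon> :: real
  proof -
    obtain M where M: "\<And>s \<tau>. 0 \<le> s \<Longrightarrow> M * \<bar>\<tau>\<bar> \<le> s \<Longrightarrow> cmod (\<phi> (Complex (-s) \<tau>)) \<le> D * exp (\<epsilon> * \<bar>\<tau>\<bar>)"
      using neg[OF \<epsilon>] by blast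
    \<comment> \<open>A small \<open>\<delta>\<close> places the second ray in the region governed
      by \<open>M\<close> and keeps \<open>t\<close> inside the sector.\<close>
    have "((\<lambda>\<delta>. cos \<delta> - M * sin \<delta>) \<longlongrightarrow> cos 0 - M * sin 0) (at_right 0)"
      by (intro tendsto_intros)
    then have "eventually (\<lambda>\<delta>. cos \<delta> - M * sin \<delta> > 0) (at_right 0)"
      by (intro order_tendstoD(1)) auto
    moreover have "eventually (\<lambda>\<delta>. \<delta> \<in> {0<..<min (pi / 2) (pi - Arg t)}) (at_right 0)"
      using \<theta> by (intro eventually_at_right_real) auto
    ultimately have "eventually (\<lambda>\<delta>. cos \<delta> - M * sin \<delta> > 0 \<and> \<delta> \<in> {0<..<min (pi / 2) (pi - Arg t)}) (at_right 0)"
      by (rule eventually_conj)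
    from eventually_happens'[OF trivial_limit_at_right_real this]
    obtain \<delta> where \<delta>: "cos \<delta> - M * sin \<delta> > 0" "0 < \<delta>" "\<delta> < pi / 2" "\<delta> < pi - Arg t"
      by auto
    \<comment> \<open>The exponential has modulus \<open>exp (- \<epsilon> * Im z)\<close> and
      cancels the growth allowed by \<open>neg\<close>. The denominator absorbs the polynomial
      growth on the positive ray, and its zero \<open>- \<i>\<close> lies outside the closed upper
      half-plane.\<close>
    define F where "F z = \<phi> z * exp (\<i> * of_real \<epsilon> * z) / (z + \<i>) ^ K" for z
    have F: "cmod (F z) = cmod (\<phi> z) * exp (- \<epsilon> * Im z) / cmod (z + \<i>) ^ K" for z
      by (simp add: F_def norm_mult norm_divide norm_power)
    have upper: "Im (of_real r * cis \<theta>) \<ge> 0" if "0 \<le> r" "0 \<le> \<theta>" "\<theta> \<le> pi - \<delta>" for r \<theta>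
      using that \<delta> by (auto intro!: mult_nonneg_nonneg sin_ge_zero)
    have denom: "cmod (z + \<i>) ^ K \<ge> 1" if "Im z \<ge> 0" for z
      using that abs_Im_le_cmod[of "z + \<i>"] by (intro one_le_power) simp
    have F_le: "cmod (F z) \<le> cmod (\<phi> z) * exp (- \<epsilon> * Im z)" if "Im z \<ge> 0" for z
    proof -
      have "cmod (\<phi> z) * exp (- \<epsilon> * Im z) / cmod (z + \<i>) ^ K \<le> cmod (\<phi> z) * exp (- \<epsilon> * Im z) / 1"
        using denom[OF that] by (intro divide_left_mono) auto
      then show ?thesis by (simp add: F)
    qed
    have "cmod (F (of_real (cmod t) * cis (Arg t))) \<le> ?M0"
    proof (rule phragmen_lindelof_sector[of 0 "pi - \<delta>" "- {- \<i>}" F A B])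
      show "F holomorphic_on - {- \<i>}"
        unfolding F_def
        by (intro holomorphic_intros holomorphic_on_subset[OF hol]) (auto simp: eq_neg_iff_add_eq_0)
      show "of_real r * cis \<theta> \<in> - {- \<i>}" if "0 \<le> r" "0 \<le> \<theta>" "\<theta> \<le> pi - \<delta>" for r \<theta>
        using upper[OF that] by (auto simp: complex_eq_iff)
      show "cmod (F (of_real r * cis \<theta>)) \<le> A * exp (B * r)" if "0 \<le> r" "0 \<le> \<theta>" "\<theta> \<le> pi - \<delta>" for r \<theta>
      proof -
        let ?z = "of_real r * cis \<theta>"
        have "cmod (F ?z) \<le> cmod (\<phi> ?z) * exp (- \<epsilon> * Im ?z)" using F_le upper[OF that] by blast
        also have "\<dots> \<le> cmod (\<phi> ?z)" using upper[OF that] \<epsilon> by (intro mult_left_le) auto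
        also have "\<dots> \<le> A * exp (B * r)" using growth[of ?z] that by (simp add: norm_mult)
        finally show ?thesis .
      qed
      show "cmod (F (of_real r * cis 0)) \<le> ?M0" if r: "0 \<le> r" for r
      proof -
        \<comment> \<open>The two bounds give
          \<open>1 + r \<le> 2 * cmod (of_real r + \<i>)\<close>, the origin of the factor
          \<open>2 ^ K\<close>.\<close>
        have "r \<le> cmod (of_real r + \<i>)" "1 \<le> cmod (of_real r + \<i>)"
          using abs_Re_le_cmod[of "of_real r + \<i>"] abs_Im_le_cmod[of "of_real r + \<i>"] by auto
        then have "(1 + r) ^ K \<le> (2 * cmod (of_real r + \<i>)) ^ K" using r by (intro power_mono) auto
        then have "C * (1 + r) ^ K \<le> C * 2 ^ K * cmod (of_real r + \<i>) ^ K"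
          using C mult_left_mono by (fastforce simp: power_mult_distrib mult.assoc)
        then have "cmod (\<phi> (of_real r)) \<le> C * 2 ^ K * cmod (of_real r + \<i>) ^ K"
          using pos[OF r] by linarith
        moreover have "cmod (of_real r + \<i>) ^ K > 0" using denom[of "of_real r"] by simp
        ultimately have "cmod (F (of_real r)) \<le> C * 2 ^ K" unfolding F by (simp add: divide_le_eq)
        then show ?thesis by simp
      qed
      show "cmod (F (of_real r * cis (pi - \<delta>))) \<le> ?M0" if r: "0 \<le> r" for r
      proof -
        have z: "of_real r * cis (pi - \<delta>) = Complex (- (r * cos \<delta>)) (r * sin \<delta>)"
          by (simp add: complex_eq_iff)
        have sin: "sin \<delta> \<ge> 0" and cos: "cos \<delta> \<ge> 0" using \<delta> by (auto intro: sin_ge_zero cos_ge_zero)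
        have "r * (M * sin \<delta>) \<le> r * cos \<delta>" using r \<delta>(1) by (intro mult_left_mono) auto
        then have "cmod (\<phi> (Complex (- (r * cos \<delta>)) (r * sin \<delta>))) \<le> D * exp (\<epsilon> * \<bar>r * sin \<delta>\<bar>)"
          using r sin cos by (intro M) (auto simp: abs_mult mult_ac)
        then have "cmod (\<phi> (Complex (- (r * cos \<delta>)) (r * sin \<delta>))) * exp (- \<epsilon> * (r * sin \<delta>)) \<le>
            D * exp (\<epsilon> * \<bar>r * sin \<delta>\<bar>) * exp (- \<epsilon> * (r * sin \<delta>))" by (intro mult_right_mono) auto
        also have "\<dots> = D" using r sin by (simp add: mult.assoc flip: exp_add)
        finally have "cmod (F (of_real r * cis (pi - \<delta>))) \<le> D"
          using F_le[of "of_real r * cis (pi - \<delta>)"] r sin unfolding z by simp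
        then show ?thesis by simp
      qed
    qed (use \<theta> \<delta> in auto)
    moreover have "of_real (cmod t) * cis (Arg t) = t" by (metis rcis_cmod_Arg rcis_def)
    ultimately have "cmod (\<phi> t) * exp (- \<epsilon> * Im t) / cmod (t + \<i>) ^ K \<le> ?M0" by (simp add: F)
    moreover have "cmod (t + \<i>) ^ K > 0" using denom[of t] t by simp
    ultimately have "cmod (\<phi> t) * exp (- \<epsilon> * Im t) \<le> ?M0 * cmod (t + \<i>) ^ K"
      by (simp add: pos_divide_le_eq)
    then have "cmod (\<phi> t) * exp (- \<epsilon> * Im t) * exp (\<epsilon> * Im t) \<le> ?M0 * cmod (t + \<i>) ^ K * exp (\<epsilon> * Im t)"
      by (intro mult_right_mono) auto
    then show ?thesis by (simp add: mult.assoc flip: exp_add)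
  qed
  have "cmod (\<phi> t) \<le> ?M0 * cmod (t + \<i>) ^ K"
  proof (rule tendsto_lowerbound)
    have "((\<lambda>\<epsilon>. ?M0 * cmod (t + \<i>) ^ K * exp (\<epsilon> * Im t)) \<longlongrightarrow> ?M0 * cmod (t + \<i>) ^ K * exp (0 * Im t)) (at_right 0)"
      by (intro tendsto_intros)
    then show "((\<lambda>\<epsilon>. ?M0 * cmod (t + \<i>) ^ K * exp (\<epsilon> * Im t)) \<longlongrightarrow> ?M0 * cmod (t + \<i>) ^ K) (at_right 0)" by simp
    show "\<forall>\<^sub>F \<epsilon> in at_right 0. cmod (\<phi> t) \<le> ?M0 * cmod (t + \<i>) ^ K * exp (\<epsilon> * Im t)"
      using eventually_at_right_less[of 0] by eventually_elim (use bound in auto)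
  qed simp
  also have "\<dots> \<le> ?M0 * (1 + cmod t) ^ K"
    using C norm_triangle_ineq[of t \<i>] by (intro mult_left_mono power_mono) (auto simp: le_max_iff_disj)
  finally show ?thesis .
qed

text \<open>Polynomial bounds in both half-planes and on the real axis reduce the function to a
  polynomial by Liouville's theorem; boundedness on the negative half-line removes its nonconstant
  terms.\<close>

lemma entire_constant:
  assumes hol: "\<phi> holomorphic_on UNIV"
    and growth: "\<And>t. cmod (\<phi> t) \<le> A * exp (B * cmod t)"
    and pos: "\<And>x. 0 \<le> x \<Longrightarrow> cmod (\<phi> (of_real x)) \<le> C * (1 + x) ^ K"
    and neg: "\<And>\<epsilon>. \<epsilon> > 0 \<Longrightarrow> \<exists>M. \<forall>s \<tau>. 0 \<le> s \<and> M * \<bar>\<tau>\<bar> \<le> s \<longrightarrow> cmod (\<phi> (Complex (-s) \<tau>)) \<le> D * exp (\<epsilon> * \<bar>\<tau>\<bar>)"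
  shows "\<phi> t = \<phi> 0"
proof -
  let ?M0 = "max (C * 2 ^ K) D"
  have C: "C \<ge> 0" using order_trans[OF norm_ge_zero pos[of 0]] by simp
  have neg_real: "cmod (\<phi> (of_real (-s))) \<le> D" if "s \<ge> 0" for s
  proof -
    \<comment> \<open>At \<open>\<tau> = 0\<close> the exponential factor is \<open>1\<close>, so
      any \<open>\<epsilon>\<close> serves.\<close>
    obtain M where "\<forall>s \<tau>. 0 \<le> s \<and> M * \<bar>\<tau>\<bar> \<le> s \<longrightarrow> cmod (\<phi> (Complex (-s) \<tau>)) \<le> D * exp (1 * \<bar>\<tau>\<bar>)"
      using neg[of 1] by auto
    from this[rule_format, of s 0] that show ?thesis by (simp add: complex_of_real_def)
  qed
  have bound: "cmod (\<phi> t) \<le> ?M0 * (1 + cmod t) ^ K" for t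
  proof -
    have one: "(1 + cmod t) ^ K \<ge> 1" by (intro one_le_power) simp
    consider "Im t > 0" | "Im t < 0" | "Im t = 0" "Re t \<ge> 0" | "Im t = 0" "Re t < 0" by linarith
    then show ?thesis
    proof cases
      case 1
      show ?thesis
        by (rule entire_upper_half_plane_bound[OF hol growth]) (blast intro: pos neg 1)+
    next
      case 2
      \<comment> \<open>Conjugating argument and value swaps the half-planes; the hypotheses survive
        because they see only real arguments, \<open>cmod t\<close> or
        \<open>\<bar>\<tau>\<bar>\<close>.\<close>
      have "cmod ((cnj \<circ> \<phi> \<circ> cnj) (cnj t)) \<le> ?M0 * (1 + cmod (cnj t)) ^ K"
      proof (rule entire_upper_half_plane_bound)
        show "(cnj \<circ> \<phi> \<circ> cnj) holomorphic_on UNIV"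
          by (rule holomorphic_on_compose_cnj_cnj) (auto intro: holomorphic_on_subset[OF hol])
        show "cmod ((cnj \<circ> \<phi> \<circ> cnj) t) \<le> A * exp (B * cmod t)" for t
          using growth[of "cnj t"] by simp
        show "\<exists>M. \<forall>s \<tau>. 0 \<le> s \<and> M * \<bar>\<tau>\<bar> \<le> s \<longrightarrow> cmod ((cnj \<circ> \<phi> \<circ> cnj) (Complex (-s) \<tau>)) \<le> D * exp (\<epsilon> * \<bar>\<tau>\<bar>)"
          if \<epsilon>: "\<epsilon> > 0" for \<epsilon>
        proof -
          obtain M where M: "\<forall>s \<tau>. 0 \<le> s \<and> M * \<bar>\<tau>\<bar> \<le> s \<longrightarrow> cmod (\<phi> (Complex (-s) \<tau>)) \<le> D * exp (\<epsilon> * \<bar>\<tau>\<bar>)"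
            using neg[OF \<epsilon>] by blast
          then have "cmod (\<phi> (Complex (-s) (-\<tau>))) \<le> D * exp (\<epsilon> * \<bar>\<tau>\<bar>)" if "0 \<le> s" "M * \<bar>\<tau>\<bar> \<le> s" for s \<tau>
            using that by (metis abs_minus)
          then show ?thesis by (auto simp: complex_cnj)
        qed
      qed (use pos 2 in auto)
      then show ?thesis by simp
    next
      case 3
      then have "t = of_real (Re t)" "cmod t = Re t" by (auto simp: complex_eq_iff cmod_eq_Re)
      then have "cmod (\<phi> t) \<le> C * (1 + cmod t) ^ K" using pos[OF 3(2)] by simp
      also have "\<dots> \<le> ?M0 * (1 + cmod t) ^ K"
        using C mult_left_mono[of 1 "2 ^ K" C] by (intro mult_right_mono) auto
      finally show ?thesis .
    next
      case 4
      then have "t = of_real (- (- Re t))" by (auto simp: complex_eq_iff)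
      then have "cmod (\<phi> t) \<le> D" using neg_real[of "- Re t"] 4 by simp
      also have "\<dots> \<le> ?M0 * 1" by simp
      also have "\<dots> \<le> ?M0 * (1 + cmod t) ^ K"
        using C one by (intro mult_left_mono) (auto simp: le_max_iff_disj)
      finally show ?thesis .
    qed
  qed
  define c where "c k = (deriv ^^ k) \<phi> 0 / fact k" for k
  have poly: "\<phi> \<xi> = (\<Sum>k\<le>K. c k * \<xi> ^ k)" for \<xi>
    unfolding c_def
  proof (rule Liouville_polynomial[OF hol])
    fix z :: complex assume "1 \<le> cmod z"
    then have "?M0 * (1 + cmod z) ^ K \<le> ?M0 * (2 * cmod z) ^ K"
      using C by (intro mult_left_mono power_mono) (auto simp: le_max_iff_disj)
    then show "cmod (\<phi> z) \<le> ?M0 * 2 ^ K * cmod z ^ K"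
      using bound[of z] by (simp add: power_mult_distrib mult.assoc)
  qed
  \<comment> \<open>A nonconstant polynomial would exceed \<open>D\<close> far out on the negative
    half-line, against \<open>neg_real\<close>.\<close>
  have "c k = 0" if k: "1 \<le> k" "k \<le> K" for k
  proof (rule ccontr)
    assume "c k \<noteq> 0"
    with k have "\<exists>k. k \<noteq> 0 \<and> k \<le> K \<and> c k \<noteq> 0" by (intro exI[of _ k]) auto
    from polyfun_extremal[OF this, of "D + 1"]
    obtain R where R: "\<And>z. R \<le> cmod z \<Longrightarrow> D + 1 \<le> cmod (\<Sum>i\<le>K. c i * z ^ i)"
      by (auto simp: eventually_at_infinity)
    have "D + 1 \<le> cmod (\<phi> (of_real (- \<bar>R\<bar>)))" unfolding poly by (rule R) simp
    with neg_real[of "\<bar>R\<bar>"] show False by simp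
  qed
  then have "\<phi> \<xi> = c 0" for \<xi>
    unfolding poly by (subst sum.remove[of _ 0]) auto
  then show ?thesis by simp
qed

subsection \<open>The entire functions \<open>t \<mapsto> \<langle>exp (t v) a, f\<rangle>\<close>\<close>

text \<open>Coefficients are compared in \<open>h' = t * v' * h\<close>. Starting from
  \<open>exp (t * v 0)\<close>, the recursion makes every coefficient entire in \<open>t\<close> by
  strong induction.\<close>

lemma taylor_coeff_exp_Suc:
  assumes v: "v holomorphic_on ball 0 1"
  shows "taylor_coeff (\<lambda>z. exp (t * v z)) (Suc n) =
    (\<Sum>k\<le>n. t * taylor_coeff (deriv v) k * taylor_coeff (\<lambda>z. exp (t * v z)) (n - k)) / of_nat (Suc n)"
proof -
  let ?h = "\<lambda>z. exp (t * v z)"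
  have h: "?h holomorphic_on ball 0 1" by (intro holomorphic_intros v)
  have dv: "deriv v holomorphic_on ball 0 1" using v by (intro holomorphic_deriv) auto
  have "deriv ?h z = (t * deriv v z) * ?h z" if "z \<in> ball 0 1" for z
  proof (rule DERIV_imp_deriv)
    have "(v has_field_derivative deriv v z) (at z)"
      using v that by (intro holomorphic_derivI) auto
    then show "(?h has_field_derivative (t * deriv v z) * ?h z) (at z)"
      by (auto intro!: derivative_eq_intros)
  qed
  then have "taylor_coeff (deriv ?h) = taylor_coeff (\<lambda>z. (t * deriv v z) * ?h z)"
    using h by (intro taylor_coeff_cong holomorphic_deriv) auto
  then have "of_nat (Suc n) * taylor_coeff ?h (Suc n) = taylor_coeff (\<lambda>z. (t * deriv v z) * ?h z) n"
    by (metis taylor_coeff_deriv)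
  also have "\<dots> = (\<Sum>k\<le>n. taylor_coeff (\<lambda>z. t * deriv v z) k * taylor_coeff ?h (n - k))"
    by (intro taylor_coeff_mult h holomorphic_intros dv)
  also have "\<dots> = (\<Sum>k\<le>n. t * taylor_coeff (deriv v) k * taylor_coeff ?h (n - k))"
    using higher_deriv_cmult[OF dv, of 0 _ t] by (simp add: taylor_coeff_def)
  finally show ?thesis by (simp add: eq_divide_eq mult.commute del: of_nat_Suc)
qed

lemma taylor_coeff_exp_holomorphic:
  assumes v: "v holomorphic_on ball 0 1"
  shows "(\<lambda>t. taylor_coeff (\<lambda>z. exp (t * v z)) n) holomorphic_on UNIV"
proof (induction n rule: less_induct)
  case (less n)
  show ?case
  proof (cases n)
    case 0
    then show ?thesis by (auto simp: taylor_coeff_def intro!: holomorphic_intros)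
  next
    case (Suc m)
    show ?thesis
      unfolding Suc taylor_coeff_exp_Suc[OF v]
      by (intro holomorphic_intros less) (auto simp: Suc simp del: of_nat_Suc)
  qed
qed

lemma h2_inner_split:
  assumes "a \<in> H2" "b \<in> H2"
  shows "h2_inner a b = (\<Sum>n<N. a n * cnj (b n)) + h2_inner a (h2_tail N b)"
proof -
  have "(\<lambda>n. if n \<in> {..<N} then a n * cnj (b n) else 0) sums (\<Sum>n\<in>{..<N}. a n * cnj (b n))"
    by (rule sums_If_finite_set) simp
  from sums_add[OF this h2_inner_sums[OF assms(1) h2_tail_in_H2[OF assms(2), of N]]]
  have "(\<lambda>n. a n * cnj (b n)) sums ((\<Sum>n<N. a n * cnj (b n)) + h2_inner a (h2_tail N b))"
    by (rule sums_cong[THEN iffD1, rotated]) (auto simp: h2_tail_def)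
  then show ?thesis by (simp add: h2_inner_def sums_iff)
qed

section \<open>Exponential symbols with bounded exponent\<close>

locale exp_symbol =
  fixes v :: "complex \<Rightarrow> complex" and B :: real
  assumes hol: "v holomorphic_on ball 0 1"
    and bound: "\<And>z. cmod z < 1 \<Longrightarrow> cmod (v z) \<le> B"
begin

abbreviation E :: "complex \<Rightarrow> complex \<Rightarrow> complex" where
  "E t \<equiv> (\<lambda>z. exp (t * v z))"

lemma E_holomorphic: "E t holomorphic_on ball 0 1"
  by (intro holomorphic_intros hol)

lemma Re_mult_le:
  assumes "cmod z < 1"
  shows "Re (t * v z) \<le> B * cmod t"
proof -
  have "Re (t * v z) \<le> cmod (v z) * cmod t"
    using complex_Re_le_cmod[of "t * v z"] by (simp only: norm_mult mult.commute)
  also have "\<dots> \<le> B * cmod t" using bound[OF assms] by (rule mult_right_mono) simp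
  finally show ?thesis .
qed

lemma toeplitz_E:
  assumes "\<And>z. cmod z < 1 \<Longrightarrow> Re (t * v z) \<le> q" "a \<in> H2"
  shows "toeplitz (E t) a \<in> H2" "h2_norm (toeplitz (E t) a) \<le> exp q * h2_norm a"
  using toeplitz_bounded[OF E_holomorphic, of t "exp q" a] assms by auto

text \<open>The source of all growth bounds obtained from the exponent alone:
  \<open>q = B * cmod t\<close> gives exponential type,
  \<open>q = \<epsilon> * \<bar>\<tau>\<bar>\<close> the bound in the thin sector, and
  \<open>q = 0\<close> the bound on the negative half-line.\<close>

lemma norm_h2_inner_E_le:
  assumes "\<And>z. cmod z < 1 \<Longrightarrow> Re (t * v z) \<le> q" "a \<in> H2" "f \<in> H2"
  shows "cmod (h2_inner (toeplitz (E t) a) f) \<le> exp q * h2_norm a * h2_norm f"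
proof -
  note T = toeplitz_E[of t q, OF assms(1,2)]
  have "cmod (h2_inner (toeplitz (E t) a) f) \<le> h2_norm (toeplitz (E t) a) * h2_norm f"
    using T(1) assms(3) by (rule norm_h2_inner_le)
  also have "\<dots> \<le> exp q * h2_norm a * h2_norm f"
    using T(2) h2_norm_nonneg[OF assms(3)] by (intro mult_right_mono)
  finally show ?thesis .
qed

lemma toeplitz_E_coeff_holomorphic: "(\<lambda>t. toeplitz (E t) a n) holomorphic_on UNIV"
  unfolding toeplitz_def by (intro holomorphic_intros taylor_coeff_exp_holomorphic hol)

text \<open>The partial sums are entire, and their error is a pairing with the tail of
  \<open>f\<close>. The operators are bounded uniformly for \<open>t\<close> in a unit disc, so
  convergence is locally uniform.\<close>

lemma h2_inner_E_holomorphic: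
  assumes a: "a \<in> H2" and f: "f \<in> H2"
  shows "(\<lambda>t. h2_inner (toeplitz (E t) a) f) holomorphic_on UNIV"
proof (rule holomorphic_uniform_sequence[OF open_UNIV])
  show "(\<lambda>t. \<Sum>n<N. toeplitz (E t) a n * cnj (f n)) holomorphic_on UNIV" for N
    by (intro holomorphic_intros toeplitz_E_coeff_holomorphic)
  fix t0 :: complex
  have B: "B \<ge> 0" using order_trans[OF norm_ge_zero bound[of 0]] by simp
  define q where "q = B * (cmod t0 + 1)"
  have "uniform_limit (cball t0 1) (\<lambda>N t. \<Sum>n<N. toeplitz (E t) a n * cnj (f n))
      (\<lambda>t. h2_inner (toeplitz (E t) a) f) sequentially"
  proof (rule uniform_limitI)
    fix e :: real assume e: "e > 0"
    have "(\<lambda>N. exp q * h2_norm a * h2_norm (h2_tail N f)) \<longlonglongrightarrow> exp q * h2_norm a * 0"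
      by (intro tendsto_intros h2_tail_tendsto_0 f)
    then have "\<forall>\<^sub>F N in sequentially. exp q * h2_norm a * h2_norm (h2_tail N f) < e"
      using e by (intro order_tendstoD(2)) auto
    then show "\<forall>\<^sub>F N in sequentially. \<forall>t\<in>cball t0 1.
        dist (\<Sum>n<N. toeplitz (E t) a n * cnj (f n)) (h2_inner (toeplitz (E t) a) f) < e"
    proof eventually_elim
      case (elim N)
      show ?case
      proof
        fix t assume "t \<in> cball t0 1"
        then have "cmod t \<le> cmod t0 + 1"
          using norm_triangle_sub[of t t0] by (simp add: dist_norm norm_minus_commute)
        then have "B * cmod t \<le> q" unfolding q_def using B by (intro mult_left_mono)
        then have q: "Re (t * v z) \<le> q" if "cmod z < 1" for z
          using Re_mult_le[OF that, of t] by linarith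
        have "dist (\<Sum>n<N. toeplitz (E t) a n * cnj (f n)) (h2_inner (toeplitz (E t) a) f) =
            cmod (h2_inner (toeplitz (E t) a) (h2_tail N f))"
          using h2_inner_split[OF toeplitz_E(1)[of t q, OF q a] f, of N] by (simp add: dist_norm)
        also have "\<dots> \<le> exp q * h2_norm a * h2_norm (h2_tail N f)"
          using q a h2_tail_in_H2[OF f] by (rule norm_h2_inner_E_le)
        finally show "dist (\<Sum>n<N. toeplitz (E t) a n * cnj (f n)) (h2_inner (toeplitz (E t) a) f) < e"
          using elim by linarith
      qed
    qed
  qed
  then show "\<exists>d. 0 < d \<and> cball t0 d \<subseteq> UNIV \<and> uniform_limit (cball t0 d)
      (\<lambda>N t. \<Sum>n<N. toeplitz (E t) a n * cnj (f n)) (\<lambda>t. h2_inner (toeplitz (E t) a) f) sequentially"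
    by (intro exI[of _ 1]) auto
qed

lemma toeplitz_E_0: "toeplitz (E 0) a = a"
proof
  fix n
  have "taylor_coeff (\<lambda>z. 1) k = (if k = 0 then 1 else 0)" for k
    by (simp add: taylor_coeff_def)
  then show "toeplitz (E 0) a n = a n"
    by (simp add: toeplitz_def if_distrib[of "\<lambda>x. x * _"] cong: if_cong)
qed

text \<open>On a smaller disc \<open>Re v\<close> is bounded away from \<open>0\<close>, so Cauchy's estimates
  force every Taylor coefficient of \<open>exp (- s v)\<close> to \<open>0\<close>.\<close>

lemma toeplitz_E_coeff_tendsto_0:
  assumes pos: "\<And>z. cmod z < 1 \<Longrightarrow> Re (v z) > 0"
  shows "((\<lambda>s. toeplitz (E (of_real (-s))) a n) \<longlongrightarrow> 0) at_top"
proof -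
  have cont: "continuous_on (cball 0 (1/2)) v"
    by (rule continuous_on_subset[OF holomorphic_on_imp_continuous_on[OF hol]]) auto
  have "continuous_on (cball 0 (1/2)) (\<lambda>z. Re (v z))"
    by (intro continuous_intros cont)
  then obtain z0 where z0: "z0 \<in> cball 0 (1/2)" "\<And>z. z \<in> cball 0 (1/2) \<Longrightarrow> Re (v z0) \<le> Re (v z)"
    using continuous_attains_inf[of "cball 0 (1/2)" "\<lambda>z. Re (v z)"] by auto
  define \<delta> where "\<delta> = Re (v z0)"
  have \<delta>: "\<delta> > 0" unfolding \<delta>_def using z0(1) by (intro pos) auto
  have coeff: "((\<lambda>s. taylor_coeff (E (of_real (-s))) k) \<longlongrightarrow> 0) at_top" for k
  proof (rule Lim_null_comparison)
    show "\<forall>\<^sub>F s in at_top. cmod (taylor_coeff (E (of_real (-s))) k) \<le> exp (- (\<delta> * s)) / (1/2) ^ k"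
      using eventually_ge_at_top[of 0]
    proof eventually_elim
      case (elim s)
      have "cmod ((deriv ^^ k) (E (of_real (-s))) 0) \<le> fact k * exp (- (\<delta> * s)) / (1/2) ^ k"
      proof (rule Cauchy_inequality)
        show "E (of_real (-s)) holomorphic_on ball 0 (1/2)"
          by (rule holomorphic_on_subset[OF E_holomorphic]) auto
        show "continuous_on (cball 0 (1/2)) (E (of_real (-s)))"
          by (intro continuous_intros cont)
        show "cmod (exp (of_real (-s) * v z)) \<le> exp (- (\<delta> * s))" if "cmod (0 - z) = 1/2" for z
          using z0(2)[of z] that elim by (auto simp: \<delta>_def mult.commute intro: mult_left_mono)
      qed simp
      then show ?case by (simp add: taylor_coeff_def norm_divide field_simps)
    qed
    have "((\<lambda>s. exp (- (\<delta> * s)) / (1/2) ^ k) \<longlongrightarrow> 0 / (1/2) ^ k) at_top"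
    proof (intro tendsto_intros filterlim_compose[OF exp_at_bot])
      show "filterlim (\<lambda>s. - (\<delta> * s)) at_bot at_top"
        unfolding filterlim_uminus_at_bot minus_minus
        using \<delta> by (intro filterlim_tendsto_pos_mult_at_top[OF tendsto_const] filterlim_ident) auto
    qed simp
    then show "((\<lambda>s. exp (- (\<delta> * s)) / (1/2) ^ k) \<longlongrightarrow> 0) at_top" by simp
  qed
  have "((\<lambda>s. \<Sum>k\<le>n. taylor_coeff (E (of_real (-s))) k * a (n - k)) \<longlongrightarrow> (\<Sum>k\<le>n. 0 * a (n - k))) at_top"
    by (intro tendsto_intros coeff)
  then show ?thesis by (simp add: toeplitz_def)
qed

text \<open>Constancy allows evaluation at \<open>- s\<close> for large \<open>s\<close>. There the
  first \<open>N\<close> coefficients tend to \<open>0\<close>, while \<open>exp (- s v)\<close> has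
  modulus at most \<open>1\<close>, so the remainder is controlled by the tail of \<open>f\<close>
  uniformly in \<open>s\<close>.\<close>

lemma h2_inner_eq_0_if_constant:
  assumes pos: "\<And>z. cmod z < 1 \<Longrightarrow> Re (v z) > 0" and a: "a \<in> H2" and f: "f \<in> H2"
    and const: "\<And>t. h2_inner (toeplitz (E t) a) f = h2_inner a f"
  shows "h2_inner a f = 0"
proof -
  have "cmod (h2_inner a f) \<le> h2_norm a * h2_norm (h2_tail N f)" for N
  proof (rule tendsto_lowerbound)
    have "((\<lambda>s. cmod (\<Sum>n<N. toeplitz (E (of_real (-s))) a n * cnj (f n)) + h2_norm a * h2_norm (h2_tail N f))
        \<longlongrightarrow> cmod (\<Sum>n<N. 0 * cnj (f n)) + h2_norm a * h2_norm (h2_tail N f)) at_top"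
      by (intro tendsto_intros toeplitz_E_coeff_tendsto_0 pos)
    then show "((\<lambda>s. cmod (\<Sum>n<N. toeplitz (E (of_real (-s))) a n * cnj (f n)) + h2_norm a * h2_norm (h2_tail N f))
        \<longlongrightarrow> h2_norm a * h2_norm (h2_tail N f)) at_top" by simp
    show "\<forall>\<^sub>F s in at_top. cmod (h2_inner a f) \<le>
        cmod (\<Sum>n<N. toeplitz (E (of_real (-s))) a n * cnj (f n)) + h2_norm a * h2_norm (h2_tail N f)"
      using eventually_ge_at_top[of 0]
    proof eventually_elim
      case (elim s)
      have le: "Re (of_real (-s) * v z) \<le> 0" if "cmod z < 1" for z
        using pos[OF that] elim by simp
      have "h2_inner a f = h2_inner (toeplitz (E (of_real (-s))) a) f" by (simp only: const)
      also have "\<dots> = (\<Sum>n<N. toeplitz (E (of_real (-s))) a n * cnj (f n)) +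
          h2_inner (toeplitz (E (of_real (-s))) a) (h2_tail N f)"
        by (rule h2_inner_split[OF toeplitz_E(1)[OF le a] f])
      finally have "cmod (h2_inner a f) \<le> cmod (\<Sum>n<N. toeplitz (E (of_real (-s))) a n * cnj (f n)) +
          cmod (h2_inner (toeplitz (E (of_real (-s))) a) (h2_tail N f))"
        using norm_triangle_ineq by metis
      also have "cmod (h2_inner (toeplitz (E (of_real (-s))) a) (h2_tail N f)) \<le>
          exp 0 * h2_norm a * h2_norm (h2_tail N f)"
        using le a h2_tail_in_H2[OF f] by (rule norm_h2_inner_E_le)
      finally show ?case by simp
    qed
  qed simp
  moreover have "(\<lambda>N. h2_norm a * h2_norm (h2_tail N f)) \<longlonglongrightarrow> h2_norm a * 0"
    by (intro tendsto_intros h2_tail_tendsto_0 f)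
  ultimately have "cmod (h2_inner a f) \<le> h2_norm a * 0"
    by (intro tendsto_lowerbound[of "\<lambda>N. h2_norm a * h2_norm (h2_tail N f)"]) auto
  then show ?thesis by simp
qed

end

subsection \<open>Growth of the adjoint powers\<close>

text \<open>The points with \<open>\<epsilon> \<le> \<bar>Im w\<bar>\<close> form a compact set away
  from the imaginary axis, so their real parts have a positive lower bound and a steep slope
  suffices. At all other points \<open>\<epsilon>\<close> alone is enough.\<close>

lemma compact_Im_le_Re:
  assumes K: "compact K" and nonneg: "\<And>w. w \<in> K \<Longrightarrow> Re w \<ge> 0"
    and zero: "\<And>w. w \<in> K \<Longrightarrow> Re w = 0 \<Longrightarrow> w = 0" and \<epsilon>: "\<epsilon> > 0"
  obtains M where "\<And>w. w \<in> K \<Longrightarrow> \<bar>Im w\<bar> \<le> M * Re w + \<epsilon>"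
proof -
  let ?K' = "K \<inter> {w. \<epsilon> \<le> \<bar>Im w\<bar>}"
  have "closed {w. \<epsilon> \<le> \<bar>Im w\<bar>}" by (intro closed_Collect_le continuous_intros)
  with K have K': "compact ?K'" by (rule compact_Int_closed)
  obtain b where b: "\<And>w. w \<in> K \<Longrightarrow> cmod w \<le> b"
    using compact_imp_bounded[OF K] by (auto simp: bounded_iff)
  obtain \<delta> where \<delta>: "\<delta> > 0" "\<And>w. w \<in> ?K' \<Longrightarrow> \<delta> \<le> Re w"
  proof (cases "?K' = {}")
    case True
    \<comment> \<open>With no such points, any positive \<open>\<delta>\<close> serves.\<close>
    then show ?thesis using that[of 1] by auto
  next
    case False
    have "continuous_on ?K' Re" by (intro continuous_intros)
    from continuous_attains_inf[OF K' False this]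
    obtain w0 where w0: "w0 \<in> ?K'" "\<And>w. w \<in> ?K' \<Longrightarrow> Re w0 \<le> Re w" by blast
    have "w0 \<noteq> 0" using w0(1) \<epsilon> by auto
    then have "Re w0 > 0" using w0(1) nonneg[of w0] zero[of w0] by force
    then show ?thesis using that w0(2) by blast
  qed
  show thesis
  proof (rule that)
    fix w assume w: "w \<in> K"
    have b0: "b \<ge> 0" using order_trans[OF norm_ge_zero b[OF w]] .
    show "\<bar>Im w\<bar> \<le> (b / \<delta>) * Re w + \<epsilon>"
    proof (cases "\<epsilon> \<le> \<bar>Im w\<bar>")
      case True
      then have "(b / \<delta>) * \<delta> \<le> (b / \<delta>) * Re w"
        using \<delta> w b0 by (intro mult_left_mono) auto
      then have "b \<le> (b / \<delta>) * Re w" using \<delta> by simp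
      then show ?thesis using b[OF w] abs_Im_le_cmod[of w] \<epsilon> by linarith
    next
      case False
      then show ?thesis using b0 \<delta> nonneg[OF w] by (intro add_increasing) auto
    qed
  qed
qed

text \<open>A finite upper limit bounds the terms beyond some \<open>N\<close>; the sum
  \<open>s\<close> covers the earlier ones. Rounding the exponent up and using base
  \<open>1 + real n\<close> gives an ordinary power that also works at \<open>n = 0\<close>.\<close>

lemma polynomial_bound_if_limsup_finite:
  fixes x :: "nat \<Rightarrow> real"
  assumes nonneg: "\<And>n. x n \<ge> 0" and lim: "limsup (\<lambda>n. ereal (real n powr (-k) * x n)) \<noteq> \<infinity>"
  obtains C K where "\<And>n. x n \<le> C * (1 + real n) ^ K"
proof -
  obtain c :: real where "limsup (\<lambda>n. ereal (real n powr (-k) * x n)) < ereal c"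
    using lim less_PInf_Ex_of_nat by blast
  then have "\<forall>\<^sub>F n in sequentially. ereal (real n powr (-k) * x n) < ereal c"
    by (rule Limsup_lessD)
  then obtain N where N: "\<And>n. n \<ge> N \<Longrightarrow> real n powr (-k) * x n < c"
    by (auto simp: eventually_sequentially)
  define K where "K = nat \<lceil>\<bar>k\<bar>\<rceil>"
  have K: "k \<le> real K" unfolding K_def by linarith
  define s where "s = (\<Sum>i\<le>N. x i)"
  have s0: "s \<ge> 0" unfolding s_def by (intro sum_nonneg nonneg)
  show thesis
  proof (rule that)
    fix n
    have one: "(1 + real n) ^ K \<ge> 1" by (intro one_le_power) simp
    show "x n \<le> (\<bar>c\<bar> + s) * (1 + real n) ^ K"
    proof (cases "n \<le> N")
      case True
      then have "x n \<le> s" unfolding s_def by (intro member_le_sum nonneg) auto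
      also have "\<dots> \<le> (\<bar>c\<bar> + s) * 1" by simp
      also have "\<dots> \<le> (\<bar>c\<bar> + s) * (1 + real n) ^ K"
        using one s0 by (intro mult_left_mono) auto
      finally show ?thesis .
    next
      case False
      \<comment> \<open>Positivity matters, since \<open>0 powr k = 0\<close> would break the
        cancellation of the two powers.\<close>
      then have n: "n \<ge> N" "real n > 0" by auto
      have "x n = real n powr k * (real n powr (-k) * x n)"
        using n by (simp add: powr_minus)
      also have "\<dots> \<le> real n powr k * \<bar>c\<bar>"
        using N[OF n(1)] by (intro mult_left_mono) auto
      also have "\<dots> \<le> (1 + real n) powr real K * \<bar>c\<bar>"
      proof (intro mult_right_mono)
        have "real n powr k \<le> real n powr real K" using K n by (intro powr_mono) auto
        also have "\<dots> \<le> (1 + real n) powr real K" using n by (intro powr_mono2) auto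
        finally show "real n powr k \<le> (1 + real n) powr real K" .
      qed simp
      also have "\<dots> = \<bar>c\<bar> * (1 + real n) ^ K" using n by (simp add: powr_realpow)
      also have "\<dots> \<le> (\<bar>c\<bar> + s) * (1 + real n) ^ K"
        using s0 one by (intro mult_right_mono) auto
      finally show ?thesis .
    qed
  qed
qed

text \<open>Every radial limit would have modulus \<open>1\<close>, so the almost everywhere
  condition would fail at every point of an interval of positive measure.\<close>

lemma not_bdry_gt_one_if_norm_one:
  assumes "\<And>z. cmod z < 1 \<Longrightarrow> cmod (g z) = 1"
  shows "\<not> bdry_gt_one g"
proof
  let ?M = "lebesgue_on {0..2*pi}"
  assume "bdry_gt_one g"
  then have "AE t in ?M. \<exists>L. ((\<lambda>r. g (complex_of_real r * cis t)) \<longlongrightarrow> L) (at_left 1) \<and> cmod L > 1"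
    by (simp add: bdry_gt_one_def)
  moreover have "cmod L = 1" if L: "((\<lambda>r. g (complex_of_real r * cis t)) \<longlongrightarrow> L) (at_left 1)" for t L
  proof -
    have "eventually (\<lambda>r. r \<in> {0<..<1::real}) (at_left 1)"
      by (rule eventually_at_left_real) simp
    then have "eventually (\<lambda>r. cmod (g (complex_of_real r * cis t)) = 1) (at_left 1)"
      by eventually_elim (auto simp: norm_mult intro!: assms)
    then have "((\<lambda>r. cmod (g (complex_of_real r * cis t))) \<longlongrightarrow> 1) (at_left 1)"
      by (rule tendsto_eventually)
    with tendsto_norm[OF L] show ?thesis
      by (metis tendsto_unique trivial_limit_at_left_real)
  qed
  ultimately have "AE t in ?M. False"
    by (auto elim!: eventually_mono)
  then have "ae_filter ?M = bot" using trivial_limit_def by blast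
  then have "emeasure ?M {0..2*pi} = 0" by (simp add: ae_filter_eq_bot_iff)
  then show False by (simp add: emeasure_restrict_space)
qed

section \<open>Contradiction from polynomial growth along \<open>f\<close>\<close>

theorem theorem6p6:
  fixes g u :: "complex \<Rightarrow> complex" and f :: "nat \<Rightarrow> complex"
  assumes "g \<in> Hinf"
    and "g ` ball 0 1 \<inter> ball 0 1 = {}"
    and "bdry_gt_one g"
    and "u holomorphic_on ball 0 1" and "bounded (u ` ball 0 1)"
    and "\<forall>z\<in>ball 0 1. g z = exp (u z)"
    and "\<exists>c. closure (u ` ball 0 1) \<inter> {z. Re z = 0} = {c}"
    and "f \<in> H2" and "f \<noteq> (\<lambda>_. 0)"
  shows "\<forall>k>0::real. limsup (\<lambda>n. ereal (real n powr (-k) * h2_norm ((toeplitz_adj g ^^ n) f))) = \<infinity>"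
proof (intro allI impI, rule ccontr)
  fix k :: real
  assume contra: "limsup (\<lambda>n. ereal (real n powr (-k) * h2_norm ((toeplitz_adj g ^^ n) f))) \<noteq> \<infinity>"
  note g = assms(1) and u = assms(4) and f = assms(8)
  have adj_H2: "(toeplitz_adj g ^^ n) f \<in> H2" for n using g f by (rule toeplitz_adj_power_in_H2)
  obtain C K where CK: "\<And>n. h2_norm ((toeplitz_adj g ^^ n) f) \<le> C * (1 + real n) ^ K"
    using polynomial_bound_if_limsup_finite[OF h2_norm_nonneg[OF adj_H2] contra] by blast
  have C: "C \<ge> 0" using order_trans[OF h2_norm_nonneg[OF adj_H2] CK[of 0]] by simp
  obtain c where c: "closure (u ` ball 0 1) \<inter> {z. Re z = 0} = {c}" using assms(7) by blast
  then have Re_c: "Re c = 0" by auto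
  have gu: "g z = exp (u z)" if "cmod z < 1" for z using assms(6) that by simp
  have Re_u: "Re (u z) \<ge> 0" if "cmod z < 1" for z
  proof -
    have "g z \<notin> ball 0 1" using assms(2) that mem_ball_0 by blast
    then show ?thesis using gu[OF that] by simp
  qed
  have Re_u_pos: "Re (u z) > 0" if z: "cmod z < 1" for z
  proof (rule ccontr)
    assume "\<not> Re (u z) > 0"
    then have Re0: "Re (u z) = 0" using Re_u[OF z] by simp
    \<comment> \<open>\<open>exp (- u)\<close> has modulus at most \<open>1\<close> and attains it
      at \<open>z\<close>. The maximum modulus principle makes it constant, hence \<open>g\<close>
      unimodular on the disc, against the boundary condition.\<close>
    have "(\<lambda>w. exp (- u w)) constant_on ball 0 1"
    proof (rule maximum_modulus_principle[of _ "ball 0 1" "ball 0 1" z])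
      show "(\<lambda>w. exp (- u w)) holomorphic_on ball 0 1" by (intro holomorphic_intros u)
    qed (use z Re0 Re_u in auto)
    then have "exp (- u w) = exp (- u z)" if "cmod w < 1" for w
      using that z by (auto simp: constant_on_def)
    then have "exp (- Re (u w)) = exp (- Re (u z))" if "cmod w < 1" for w
      using that norm_exp_eq_Re[of "- u w"] norm_exp_eq_Re[of "- u z"] by simp
    then have "cmod (g w) = 1" if "cmod w < 1" for w
      using that Re0 gu[OF that] by simp
    with not_bdry_gt_one_if_norm_one assms(3) show False by blast
  qed
  \<comment> \<open>Since \<open>c\<close> is imaginary, the shift keeps real parts and moves the
    contact point with the axis to \<open>0\<close>.\<close>
  define v where "v z = u z - c" for z
  have Re_v: "Re (v z) > 0" if "cmod z < 1" for z using Re_u_pos[OF that] Re_c by (simp add: v_def)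
  obtain Bu where Bu: "\<And>z. cmod z < 1 \<Longrightarrow> cmod (u z) \<le> Bu"
    using assms(5) unfolding bounded_iff by force
  interpret exp_symbol v "Bu + cmod c"
  proof
    show "v holomorphic_on ball 0 1" unfolding v_def by (intro holomorphic_intros u)
    show "cmod (v z) \<le> Bu + cmod c" if "cmod z < 1" for z
      using Bu[OF that] norm_triangle_ineq4[of "u z" c] by (simp add: v_def)
  qed
  define B where "B = Bu + cmod c"
  define \<phi> where "\<phi> t = h2_inner (toeplitz (E t) f) f" for t
  have B0: "B \<ge> 0" using order_trans[OF norm_ge_zero bound[of 0]] by (simp add: B_def)
  have f0: "h2_norm f \<ge> 0" using f by (rule h2_norm_nonneg)
  have "\<phi> t = \<phi> 0" for t
  proof (rule entire_constant)
    show "\<phi> holomorphic_on UNIV" unfolding \<phi>_def by (intro h2_inner_E_holomorphic f)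
    show "cmod (\<phi> t) \<le> (h2_norm f)\<^sup>2 * exp (B * cmod t)" for t
      using norm_h2_inner_E_le[OF Re_mult_le f f, of t]
      by (simp add: \<phi>_def B_def power2_eq_square mult_ac)
    show "cmod (\<phi> (of_real x)) \<le> (exp B * h2_norm f * C) * (1 + x) ^ K" if x: "0 \<le> x" for x
    proof -
      \<comment> \<open>The assumed growth concerns integer powers of \<open>g\<close> only, so
        \<open>exp (x v)\<close> is split as \<open>h * g ^ n\<close> with \<open>n\<close> the
        integer part of \<open>x\<close>. The bound on \<open>h\<close> uses
        \<open>s \<le> 1\<close> and \<open>Re c = 0\<close>.\<close>
      define n where "n = nat \<lfloor>x\<rfloor>"
      define s where "s = x - real n"
      have s: "0 \<le> s" "s \<le> 1" and n: "real n \<le> x" using x by (auto simp: n_def s_def) linarith+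
      define h where "h z = exp (of_real s * v z - of_nat n * c)" for z
      have h_hol: "h holomorphic_on ball 0 1" unfolding h_def by (intro holomorphic_intros hol)
      have h_le: "cmod (h z) \<le> exp B" if "cmod z < 1" for z
      proof -
        have "Re (of_real s * v z) \<le> B * s"
          using Re_mult_le[OF that, of "of_real s"] s by (simp add: B_def)
        also have "\<dots> \<le> B" using s B0 by (intro mult_left_le) auto
        finally show ?thesis by (simp add: h_def Re_c)
      qed
      have "h \<in> Hinf" using h_hol h_le by (auto simp: Hinf_def intro!: boundedI[where B = "exp B"])
      have "toeplitz (E (of_real x)) f = toeplitz (\<lambda>z. h z * g z ^ n) f"
      proof (rule toeplitz_cong[OF E_holomorphic])
        fix z :: complex assume "z \<in> ball 0 1"
        then have "h z * g z ^ n = exp (of_real s * v z - of_nat n * c + of_nat n * u z)"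
          using gu by (simp add: h_def exp_of_nat_mult exp_add)
        also have "of_real s * v z - of_nat n * c + of_nat n * u z = of_real x * v z"
          by (simp add: s_def v_def algebra_simps)
        finally show "exp (of_real x * v z) = h z * g z ^ n" by simp
      qed
      then have "cmod (\<phi> (of_real x)) = cmod (h2_inner (toeplitz h f) ((toeplitz_adj g ^^ n) f))"
        using h2_inner_toeplitz_power[OF g \<open>h \<in> Hinf\<close> f f] by (simp add: \<phi>_def)
      also have "\<dots> \<le> h2_norm (toeplitz h f) * h2_norm ((toeplitz_adj g ^^ n) f)"
        using toeplitz_in_H2[OF h_hol h_le f] adj_H2 by (rule norm_h2_inner_le)
      also have "\<dots> \<le> (exp B * h2_norm f) * (C * (1 + real n) ^ K)"
        using h2_norm_toeplitz_le[OF h_hol h_le f] CK f0 h2_norm_nonneg[OF adj_H2]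
        by (intro mult_mono) auto
      also have "\<dots> \<le> (exp B * h2_norm f) * (C * (1 + x) ^ K)"
        using n C f0 by (intro mult_left_mono power_mono) auto
      finally show ?thesis by (simp add: mult.assoc)
    qed
    show "\<exists>M. \<forall>s \<tau>. 0 \<le> s \<and> M * \<bar>\<tau>\<bar> \<le> s \<longrightarrow>
        cmod (\<phi> (Complex (-s) \<tau>)) \<le> (h2_norm f)\<^sup>2 * exp (\<epsilon> * \<bar>\<tau>\<bar>)" if \<epsilon>: "\<epsilon> > 0" for \<epsilon>
    proof -
      \<comment> \<open>The closure of the range of \<open>v\<close>: compact, in the closed right
        half-plane, and touching the imaginary axis only at \<open>0\<close>.\<close>
      let ?K = "(\<lambda>w. - c + w) ` closure (u ` ball 0 1)"
      have K: "compact ?K" using assms(5) by (intro compact_translation) auto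
      have K_nonneg: "Re w \<ge> 0" if "w \<in> ?K" for w
      proof -
        have "closure (u ` ball 0 1) \<subseteq> {w. Re w \<ge> 0}"
          using Re_u by (intro closure_minimal closed_halfspace_Re_ge) auto
        then show ?thesis using that Re_c by auto
      qed
      have K_zero: "w = 0" if w: "w \<in> ?K" "Re w = 0" for w
      proof -
        obtain y where y: "y \<in> closure (u ` ball 0 1)" "w = - c + y" using w(1) by blast
        then have "Re y = 0" using w(2) Re_c by simp
        with y(1) c have "y = c" by blast
        then show ?thesis using y(2) by simp
      qed
      obtain M where M: "\<And>w. w \<in> ?K \<Longrightarrow> \<bar>Im w\<bar> \<le> M * Re w + \<epsilon>"
        using compact_Im_le_Re[OF K K_nonneg K_zero \<epsilon>] by blast
      have v: "\<bar>Im (v z)\<bar> \<le> M * Re (v z) + \<epsilon>" if "cmod z < 1" for z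
      proof -
        have "u z \<in> closure (u ` ball 0 1)" using that closure_subset by fastforce
        then have "- c + u z \<in> ?K" by blast
        from M[OF this] show ?thesis by (simp add: v_def)
      qed
      have "cmod (\<phi> (Complex (-s) \<tau>)) \<le> (h2_norm f)\<^sup>2 * exp (\<epsilon> * \<bar>\<tau>\<bar>)" if s: "M * \<bar>\<tau>\<bar> \<le> s" for s \<tau>
      proof -
        have "Re (Complex (-s) \<tau> * v z) \<le> \<epsilon> * \<bar>\<tau>\<bar>" if z: "cmod z < 1" for z
        proof -
          have "Re (Complex (-s) \<tau> * v z) = - (s * Re (v z)) - \<tau> * Im (v z)" by simp
          \<comment> \<open>The lower bound on \<open>s\<close> and the upper bound on
            \<open>\<bar>Im (v z)\<bar>\<close> carry the same slope \<open>M\<close>, so the terms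
            in \<open>Re (v z)\<close> cancel.\<close>
          also have "\<dots> \<le> - (M * \<bar>\<tau>\<bar> * Re (v z)) + \<bar>\<tau>\<bar> * (M * Re (v z) + \<epsilon>)"
          proof -
            have "M * \<bar>\<tau>\<bar> * Re (v z) \<le> s * Re (v z)"
              using s Re_v[OF z] by (intro mult_right_mono) auto
            moreover have "- (\<tau> * Im (v z)) \<le> \<bar>\<tau>\<bar> * \<bar>Im (v z)\<bar>"
              by (metis abs_ge_minus_self abs_mult)
            moreover have "\<bar>\<tau>\<bar> * \<bar>Im (v z)\<bar> \<le> \<bar>\<tau>\<bar> * (M * Re (v z) + \<epsilon>)"
              using v[OF z] by (intro mult_left_mono) auto
            ultimately show ?thesis by linarith
          qed
          also have "\<dots> = \<epsilon> * \<bar>\<tau>\<bar>" by (simp add: algebra_simps)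
          finally show ?thesis .
        qed
        from norm_h2_inner_E_le[OF this f f] show ?thesis
          by (simp add: \<phi>_def power2_eq_square mult_ac)
      qed
      then show ?thesis by blast
    qed
  qed
  \<comment> \<open>At \<open>t = 0\<close> the symbol is \<open>1\<close>, so the constant value is
    the squared norm of \<open>f\<close>.\<close>
  then have "h2_inner (toeplitz (E t) f) f = h2_inner f f" for t
    by (simp only: \<phi>_def toeplitz_E_0)
  from h2_inner_eq_0_if_constant[OF Re_v f f this] have "h2_inner f f = 0" .
  moreover have "h2_inner f f = of_real (\<Sum>n. (cmod (f n))\<^sup>2)"
    using f by (simp add: h2_inner_def H2_def suminf_of_real flip: complex_norm_square)
  ultimately have "(\<Sum>n. (cmod (f n))\<^sup>2) = 0" by simp
  then have "f n = 0" for n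
    using f suminf_eq_zero_iff[of "\<lambda>n. (cmod (f n))\<^sup>2"] by (simp add: H2_def)
  with assms(9) show False by auto
qed

end
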